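(* Let $(\mathfrak g,\mathfrak v,\pi)$ be a Lorentzian data set with $\mathfrak v$ Lorentzian, and let $\mathfrak c$ be the center of $\mathfrak g$. Then: (1) $\mathfrak v$ decomposes as an orthogonal sum $$\mathfrak v=\mathfrak v_0\oplus\mathfrak v_1\oplus\cdots\oplus\mathfrak v_k$$ of $\pi(\mathfrak g)$-invariant subspaces, where $\mathfrak v_i$ is Riemannian and irreducible for $i\ge1$, and $\mathfrak v_0$ is Lorentzian of dimension $2$, which is in turn the sum of two invariant (and irreducible) one-dimensional subspaces generated by lightlike vectors. (2) For every $i=1,\dots,k$ there exists a skew-symmetric map $J_i:\mathfrak v_i\to\mathfrak v_i$ such that $J_i^2=-\mathrm{Id}$, and for every $Z\in\mathfrak c$, $$\pi(Z)|_{\mathfrak v_i}=\lambda_i(Z)J_i\quad\text{for some }\lambda_i(Z)\in\mathbb R.$$ (3) There exists $J_0\in\mathfrak{so}(\mathfrak v_0)\simeq\mathfrak{so}(1,1)$ such that $J_0^2=\mathrm{Id}$, and for every $Z\in\mathfrak c$, $$\pi(Z)|_{\mathfrak v_0}=\lambda_0(Z)J_0\quad\text{for some }\lambda_0(Z)\in\mathbb R.$$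
   Context: A metric on a real vector space is a non-degenerate symmetric bilinear form; it (or the space) is Riemannian if positive definite and Lorentzian if it has exactly one negative direction. A nonzero vector $v$ is lightlike if $\langle v,v\rangle=0$. $\mathfrak{so}(\mathfrak v)$ denotes the skew-symmetric endomorphisms of $\mathfrak v$. A Lorentzian data set is a triple $(\mathfrak g,\mathfrak v,\pi)$ where $\mathfrak g$ is a (finite-dimensional real) Lie algebra with an $\mathrm{ad}$-invariant metric $\langle\cdot,\cdot\rangle_{\mathfrak g}$ (each $\mathrm{ad}_Z$ is skew-symmetric), $\mathfrak v$ is a real vector space with a metric $\langle\cdot,\cdot\rangle_{\mathfrak v}$, and $\pi:\mathfrak g\to\mathfrak{so}(\mathfrak v,\langle\cdot,\cdot\rangle_{\mathfrak v})$ is a faithful representation with $\bigcap_{Z\in\mathfrak g}\ker\pi(Z)=\{0\}$, such that the orthogonal direct sum metric on $\mathfrak g\oplus\mathfrak v$ is Lorentzian.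
   Formalization: In (2), J_i is asserted only when dim v_i is even; for odd-dimensional v_i, where no such J_i exists (e.g. so(3) acting on R^3), it is shown instead that π(Z) = 0 on v_i for all Z in the center. The space v is taken to be finite-dimensional. *)

theory Defs
  imports "HOL-Analysis.Analysis"
begin

section \<open>Metrics on real vector spaces\<close>

text \<open>
  A metric is a function of two arguments on the whole type. The notions for spaces with a
  metric are relative to a linear subspace \<open>S\<close>, which carries the restricted form.
\<close>

definition finite_dim :: "'a::real_vector set \<Rightarrow> bool" where
  "finite_dim S \<longleftrightarrow> (\<exists>B. finite B \<and> span B = S)"

definition metric_on :: "'a::real_vector set \<Rightarrow> ('a \<Rightarrow> 'a \<Rightarrow> real) \<Rightarrow> bool" where
  "metric_on S b \<longleftrightarrow> bilinear b \<and> (\<forall>x y. b x y = b y x) \<and>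
     (\<forall>x\<in>S. (\<forall>y\<in>S. b x y = 0) \<longrightarrow> x = 0)"

definition riemannian_on :: "'a::real_vector set \<Rightarrow> ('a \<Rightarrow> 'a \<Rightarrow> real) \<Rightarrow> bool" where
  "riemannian_on S b \<longleftrightarrow> metric_on S b \<and> (\<forall>x\<in>S. x \<noteq> 0 \<longrightarrow> b x x > 0)"

text \<open>
  The index is the number of negative directions: the largest dimension of a negative
  definite subspace. The maximum is over a finite nonempty set of numbers when \<open>S\<close> is a
  finite-dimensional subspace, and only then is the definition meaningful.
\<close>

definition metric_index :: "'a::real_vector set \<Rightarrow> ('a \<Rightarrow> 'a \<Rightarrow> real) \<Rightarrow> nat" where
  "metric_index S b =
     Max {dim U |U. subspace U \<and> U \<subseteq> S \<and> (\<forall>x\<in>U. x \<noteq> 0 \<longrightarrow> b x x < 0)}"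

definition lorentzian_on :: "'a::real_vector set \<Rightarrow> ('a \<Rightarrow> 'a \<Rightarrow> real) \<Rightarrow> bool" where
  "lorentzian_on S b \<longleftrightarrow> finite_dim S \<and> metric_on S b \<and> metric_index S b = 1"

definition lightlike :: "('a::real_vector \<Rightarrow> 'a \<Rightarrow> real) \<Rightarrow> 'a \<Rightarrow> bool" where
  "lightlike b x \<longleftrightarrow> x \<noteq> 0 \<and> b x x = 0"

definition sum_metric ::
  "('a::real_vector \<Rightarrow> 'a \<Rightarrow> real) \<Rightarrow> ('b::real_vector \<Rightarrow> 'b \<Rightarrow> real) \<Rightarrow>
   'a \<times> 'b \<Rightarrow> 'a \<times> 'b \<Rightarrow> real" where
  "sum_metric b c p q = b (fst p) (fst q) + c (snd p) (snd q)"

text \<open>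
  Only the values of \<open>J\<close> on \<open>S\<close> matter, so that \<open>so_on S b\<close> contains every function on the
  whole type whose restriction to \<open>S\<close> is a skew-symmetric endomorphism of \<open>S\<close>.
\<close>

definition so_on :: "'a::real_vector set \<Rightarrow> ('a \<Rightarrow> 'a \<Rightarrow> real) \<Rightarrow> ('a \<Rightarrow> 'a) set" where
  "so_on S b = {J. (\<forall>x\<in>S. J x \<in> S) \<and>
     (\<forall>x\<in>S. \<forall>y\<in>S. J (x + y) = J x + J y) \<and> (\<forall>r. \<forall>x\<in>S. J (r *\<^sub>R x) = r *\<^sub>R J x) \<and>
     (\<forall>x\<in>S. \<forall>y\<in>S. b (J x) y = - b x (J y))}"

definition orthogonal_sum ::
  "('a::real_vector \<Rightarrow> 'a \<Rightarrow> real) \<Rightarrow> nat set \<Rightarrow> (nat \<Rightarrow> 'a set) \<Rightarrow> 'a set \<Rightarrow> bool" where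
  "orthogonal_sum b I V S \<longleftrightarrow>
     (\<forall>i\<in>I. subspace (V i) \<and> V i \<subseteq> S) \<and>
     (\<forall>i\<in>I. \<forall>j\<in>I. i \<noteq> j \<longrightarrow> (\<forall>x\<in>V i. \<forall>y\<in>V j. b x y = 0)) \<and>
     (\<forall>x\<in>S. \<exists>!u. u \<in> (\<Pi>\<^sub>E i\<in>I. V i) \<and> x = (\<Sum>i\<in>I. u i))"


section \<open>Lie algebras and representations\<close>

locale real_lie_algebra =
  fixes br :: "'g::real_vector \<Rightarrow> 'g \<Rightarrow> 'g"
  assumes bilinear_bracket: "bilinear br"
    and bracket_self: "br X X = 0"
    and jacobi: "br X (br Y Z) + br Y (br Z X) + br Z (br X Y) = 0"

definition lie_center :: "('g::real_vector \<Rightarrow> 'g \<Rightarrow> 'g) \<Rightarrow> 'g set" where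
  "lie_center br = {Z. \<forall>X. br Z X = 0}"

definition invariant_subspace ::
  "('g \<Rightarrow> 'v::real_vector \<Rightarrow> 'v) \<Rightarrow> 'v set \<Rightarrow> bool" where
  "invariant_subspace \<pi> U \<longleftrightarrow> subspace U \<and> (\<forall>Z. \<forall>x\<in>U. \<pi> Z x \<in> U)"

definition irreducible_subspace ::
  "('g \<Rightarrow> 'v::real_vector \<Rightarrow> 'v) \<Rightarrow> 'v set \<Rightarrow> bool" where
  "irreducible_subspace \<pi> U \<longleftrightarrow> invariant_subspace \<pi> U \<and> U \<noteq> {0} \<and>
     (\<forall>W. invariant_subspace \<pi> W \<and> W \<subseteq> U \<longrightarrow> W = {0} \<or> W = U)"

text \<open>
  Bilinearity of \<open>\<pi>\<close> says that each \<open>\<pi> Z\<close> is linear and that \<open>Z \<mapsto> \<pi> Z\<close> is linear.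
\<close>

locale lorentzian_data_set = real_lie_algebra br
  for br :: "'g::real_vector \<Rightarrow> 'g \<Rightarrow> 'g" +
  fixes bg :: "'g \<Rightarrow> 'g \<Rightarrow> real"
    and bv :: "'v::real_vector \<Rightarrow> 'v \<Rightarrow> real"
    and \<pi> :: "'g \<Rightarrow> 'v \<Rightarrow> 'v"
  assumes finite_dim_algebra: "finite_dim (UNIV :: 'g set)"
    and finite_dim_space: "finite_dim (UNIV :: 'v set)"
    and metric_algebra: "metric_on UNIV bg"
    and ad_invariant: "br Z \<in> so_on UNIV bg"
    and metric_space: "metric_on UNIV bv"
    and bilinear_rep: "bilinear \<pi>"
    and rep_skew: "\<pi> Z \<in> so_on UNIV bv"
    and rep_bracket: "\<pi> (br X Y) x = \<pi> X (\<pi> Y x) - \<pi> Y (\<pi> X x)"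
    and faithful: "inj \<pi>"
    and common_kernel: "(\<Inter>Z. {x. \<pi> Z x = 0}) = {0}"
    and lorentzian_sum: "lorentzian_on UNIV (sum_metric bg bv)"

text \<open>
  On parity: a Riemannian \<open>V\<close> carries a skew-symmetric \<open>J\<close> with \<open>J\<^sup>2 = - Id\<close> only if its
  dimension is even, and odd-dimensional irreducible summands do occur: let
  \<open>\<real> \<oplus> so(3)\<close> act on \<open>\<real>\<^sup>1\<^sup>,\<^sup>1 \<oplus> \<real>\<^sup>3\<close>, the first factor by boosts of \<open>\<real>\<^sup>1\<^sup>,\<^sup>1\<close> and the second by
  rotations of \<open>\<real>\<^sup>3\<close>. The theorem therefore asserts the existence of \<open>J\<close> on the
  even-dimensional Riemannian summands, and on the odd-dimensional ones that the centre
  acts by zero, which is what \<open>\<pi> Z = \<lambda> J\<close> amounts to there.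
\<close>

end

theory Submission
  imports Defs
begin

text \<open>
  As the space has a timelike vector, the metric of the algebra is positive definite, so that the
  Casimir operator of \<open>\<pi>\<close> is available. A maximum principle on the closed timelike cone, applied
  to its quadratic form, produces a lightlike vector \<open>e\<close> that is a common eigenvector of all
  \<open>\<pi> Z\<close>. The eigenvalue is a linear functional vanishing on brackets, hence the pairing with a
  central element \<open>H\<close>. By skewness \<open>\<pi> H\<close> has the opposite eigenvalue as well, and its eigenspace
  is invariant and totally isotropic, that is, a line spanned by a lightlike vector \<open>f\<close>. The plane
  of \<open>e\<close> and \<open>f\<close> is the Lorentzian summand; its orthogonal complement is Riemannian, hence
  completely reducible. On an irreducible summand, Schur's lemma for symmetric forms makes
  \<open>\<pi> Z \<circ> \<pi> W\<close> scalar for central \<open>Z\<close> and \<open>W\<close>.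
\<close>

section \<open>Symmetric bilinear forms\<close>

text \<open>For an indefinite form, self-adjoint maps need not have real eigenvectors, so an
  invariant lightlike line cannot be read off from a spectral theorem. What helps is a sign: for
  \<open>x\<close> nonzero with \<open>bv x x \<le> 0\<close>, the vector \<open>\<pi> Z x\<close>
  is orthogonal to \<open>x\<close> and therefore not timelike, so the Casimir form is a sum of
  nonnegative terms there. Either it vanishes at a lightlike vector, and then every term vanishes
  and the line of that vector is invariant, or it is positive and can serve as a denominator. In the
  second case the quotient by it is zero on the boundary of the cone and positive inside, so that
  its maximum is interior and yields an eigenvector equation. Vectors live in a bare
  \<open>real_vector\<close> type. Dimension counts therefore rest on bases, and compactness is
  found in spaces of coordinates.\<close>

lemma subspace_basis:
  fixes S :: "'a::real_vector set"
  assumes "finite_dim (UNIV :: 'a set)" "subspace S"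
  obtains B where "finite B" "independent B" "span B = S" "card B = dim S"
proof -
  obtain C :: "'a set" where C: "finite C" "span C = UNIV"
    using assms(1) by (auto simp: finite_dim_def)
  obtain B where B: "B \<subseteq> S" "independent B" "S \<subseteq> span B" "card B = dim S"
    using basis_exists[of S] by blast
  have "finite B"
    using independent_span_bound[OF C(1) B(2)] C(2) by auto
  moreover have "span B = S"
    using B assms(2) by (metis span_subspace)
  ultimately show ?thesis
    using that B by blast
qed

lemma card_independent_le_dim:
  fixes S :: "'a::real_vector set"
  assumes "finite_dim (UNIV :: 'a set)" "subspace S" "independent A" "A \<subseteq> S"
  shows "card A \<le> dim S"
proof -
  obtain B where "finite B" "independent B" "span B = S" "card B = dim S"
    using subspace_basis[OF assms(1,2)] by blast
  then show ?thesis
    using independent_span_bound[of B A] assms by auto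
qed

lemma subspace_dim_mono:
  fixes S T :: "'a::real_vector set"
  assumes "finite_dim (UNIV :: 'a set)" "subspace S" "subspace T" "S \<subseteq> T"
  shows "dim S \<le> dim T"
proof -
  obtain B where "finite B" "independent B" "span B = S" "card B = dim S"
    using subspace_basis[OF assms(1,2)] by blast
  then show ?thesis
    using card_independent_le_dim[OF assms(1,3), of B] assms span_superset[of B] by auto
qed

lemma subspace_dim_strict_mono:
  fixes S T :: "'a::real_vector set"
  assumes "finite_dim (UNIV :: 'a set)" "subspace S" "subspace T" "S \<subset> T"
  shows "dim S < dim T"
proof -
  obtain B where B: "finite B" "independent B" "span B = S" "card B = dim S"
    using subspace_basis[OF assms(1,2)] by blast
  obtain x where x: "x \<in> T" "x \<notin> S"
    using assms(4) by auto
  have "independent (insert x B)" "insert x B \<subseteq> T"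
    using B x assms(4) span_superset[of B] by (auto simp: independent_insert)
  then have "card (insert x B) \<le> dim T"
    by (rule card_independent_le_dim[OF assms(1,3)])
  moreover have "x \<notin> B"
    using B x span_base[of x B] by auto
  ultimately show ?thesis
    using B by simp
qed

text \<open>The image of a basis is independent with as many elements as the dimension, so its span
  is not proper. Used contrapositively, a map that misses a vector has a kernel; this yields an
  eigenvector without determinants.\<close>

lemma inj_linear_imp_surj:
  fixes f :: "'a::real_vector \<Rightarrow> 'a"
  assumes "finite_dim (UNIV :: 'a set)" "linear f" "inj f"
  shows "surj f"
proof -
  obtain B :: "'a set" where B: "finite B" "independent B" "span B = UNIV" "card B = dim (UNIV :: 'a set)"
    using subspace_basis[OF assms(1)] by (metis subspace_UNIV)
  have "independent (f ` B)"
    using linear_independent_injective_image[OF assms(2) B(2)] assms(3) by (simp add: inj_on_subset)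
  then have "dim (span (f ` B)) = card B"
    using assms(3) by (simp add: dim_eq_card_independent card_image inj_on_subset)
  then have "span (f ` B) = UNIV"
    using subspace_dim_strict_mono[OF assms(1) subspace_span subspace_UNIV] B
    by (metis less_irrefl subset_UNIV psubsetI)
  then show ?thesis
    using linear_span_image[OF assms(2), of B] B by simp
qed

section \<open>Orthonormal families, projections and orthogonal sums\<close>

locale symmetric_form =
  fixes b :: "'a::real_vector \<Rightarrow> 'a \<Rightarrow> real"
  assumes bilinear: "bilinear b" and sym: "b x y = b y x"
begin

lemma linear_left: "linear (\<lambda>x. b x y)" and linear_right: "linear (b x)"
  using bilinear by (simp_all add: bilinear_def)

lemma form_simps:
  "b (x + y) z = b x z + b y z" "b z (x + y) = b z x + b z y"
  "b (x - y) z = b x z - b y z" "b z (x - y) = b z x - b z y"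
  "b (r *\<^sub>R x) z = r * b x z" "b z (r *\<^sub>R x) = r * b z x"
  "b (- x) z = - b x z" "b z (- x) = - b z x"
  "b 0 z = 0" "b z 0 = 0"
  using bilinear_ladd[OF bilinear] bilinear_radd[OF bilinear] bilinear_lsub[OF bilinear]
    bilinear_rsub[OF bilinear] bilinear_lmul[OF bilinear] bilinear_rmul[OF bilinear]
    bilinear_lneg[OF bilinear] bilinear_rneg[OF bilinear] bilinear_lzero[OF bilinear]
    bilinear_rzero[OF bilinear]
  by simp_all

lemma sum_left: "b (\<Sum>i\<in>I. f i) z = (\<Sum>i\<in>I. b (f i) z)"
  using linear_sum[OF linear_left] .

lemma sum_right: "b z (\<Sum>i\<in>I. f i) = (\<Sum>i\<in>I. b z (f i))"
  using linear_sum[OF linear_right] .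

lemma subspace_orthogonal: "subspace {x. b x y = 0}"
  by (auto simp: subspace_def form_simps)

lemma orthogonal_span:
  assumes "\<And>x. x \<in> A \<Longrightarrow> b x y = 0" "x \<in> span A"
  shows "b x y = 0"
  using span_minimal[OF _ subspace_orthogonal, of A y] assms by auto

definition pos_def :: "'a set \<Rightarrow> bool" where
  "pos_def S \<longleftrightarrow> (\<forall>x\<in>S. x \<noteq> 0 \<longrightarrow> b x x > 0)"

definition orthonormal :: "'a set \<Rightarrow> bool" where
  "orthonormal E \<longleftrightarrow> (\<forall>x\<in>E. \<forall>y\<in>E. b x y = (if x = y then 1 else 0))"

lemma orthonormal_sum:
  assumes "finite E" "orthonormal E" "e \<in> E"
  shows "b (\<Sum>x\<in>E. c x *\<^sub>R x) e = c e"
proof -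
  have "b (\<Sum>x\<in>E. c x *\<^sub>R x) e = (\<Sum>x\<in>E. c x * b x e)"
    by (simp add: sum_left form_simps)
  also have "\<dots> = (\<Sum>x\<in>E. if x = e then c x else 0)"
    using assms by (intro sum.cong) (auto simp: orthonormal_def)
  finally show ?thesis
    using assms by simp
qed

lemma orthonormal_expansion:
  assumes "finite E" "orthonormal E" "x \<in> span E"
  shows "x = (\<Sum>e\<in>E. b x e *\<^sub>R e)"
proof -
  obtain c where "x = (\<Sum>e\<in>E. c e *\<^sub>R e)"
    using assms by (auto simp: span_finite)
  then show ?thesis
    using orthonormal_sum[OF assms(1,2)] by (metis (no_types, lifting) sum.cong)
qed

lemma orthonormal_independent:
  assumes "finite E" "orthonormal E"
  shows "independent E"
proof (rule independent_if_scalars_zero[OF assms(1)])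
  fix c e assume "(\<Sum>x\<in>E. c x *\<^sub>R x) = 0" "e \<in> E"
  then show "c e = 0"
    using orthonormal_sum[OF assms, of e c] by (simp add: form_simps)
qed

lemma orthonormal_parseval:
  assumes "finite E" "orthonormal E"
  shows "b (\<Sum>e\<in>E. c e *\<^sub>R e) (\<Sum>e\<in>E. d e *\<^sub>R e) = (\<Sum>e\<in>E. c e * d e)"
proof -
  have "b (\<Sum>e\<in>E. c e *\<^sub>R e) (\<Sum>e\<in>E. d e *\<^sub>R e) = (\<Sum>e\<in>E. d e * b (\<Sum>e\<in>E. c e *\<^sub>R e) e)"
    by (subst sum_right) (simp add: form_simps)
  also have "\<dots> = (\<Sum>e\<in>E. c e * d e)"
    using orthonormal_sum[OF assms, of _ c] by (intro sum.cong) auto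
  finally show ?thesis .
qed

lemma orthonormal_projection:
  assumes "finite E" "orthonormal E" "y \<in> span E"
  shows "b (x - (\<Sum>e\<in>E. b x e *\<^sub>R e)) y = 0"
proof -
  let ?z = "x - (\<Sum>e\<in>E. b x e *\<^sub>R e)"
  have "b e ?z = 0" if "e \<in> E" for e
    unfolding sym[of e]
    using orthonormal_sum[OF assms(1,2) that, of "b x"] by (simp add: form_simps)
  then have "b y ?z = 0"
    using assms(3) by (rule orthogonal_span)
  then show ?thesis
    by (subst sym)
qed

lemma gram_schmidt:
  assumes "finite B" "pos_def (span B)"
  shows "\<exists>E. finite E \<and> orthonormal E \<and> span E = span B"
  using assms
proof (induction B rule: finite_induct)
  case empty
  show ?case
    by (rule exI[of _ "{}"]) (auto simp: orthonormal_def)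
next
  case (insert x B)
  have "span B \<subseteq> span (insert x B)"
    by (simp add: span_mono subset_insertI)
  then have "pos_def (span B)"
    using insert.prems by (auto simp: pos_def_def)
  then obtain E where E: "finite E" "orthonormal E" "span E = span B"
    using insert.IH by blast
  define y where "y = x - (\<Sum>e\<in>E. b x e *\<^sub>R e)"
  have ye: "b y e = 0" if "e \<in> E" for e
    using orthonormal_projection[OF E(1,2), of e x] span_base[OF that] by (simp add: y_def)
  have sumE: "(\<Sum>e\<in>E. b x e *\<^sub>R e) \<in> span E"
    by (meson span_sum span_scale span_base)
  show ?case
  proof (cases "x \<in> span B")
    case True
    then have "span (insert x B) = span B"
      by (rule span_redundant)
    then show ?thesis
      using E by blast
  next
    case False
    then have "y \<noteq> 0"
      using sumE E by (auto simp: y_def)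
    moreover have "y \<in> span (insert x B)"
      unfolding y_def
    proof (rule span_diff)
      show "x \<in> span (insert x B)"
        by (simp add: span_base)
      show "(\<Sum>e\<in>E. b x e *\<^sub>R e) \<in> span (insert x B)"
        using sumE E(3) \<open>span B \<subseteq> _\<close> by blast
    qed
    ultimately have pos: "b y y > 0"
      using insert.prems by (auto simp: pos_def_def)
    define z where "z = (1 / sqrt (b y y)) *\<^sub>R y"
    have "b z z = 1"
      using pos by (simp add: z_def form_simps field_simps)
    moreover have "b z e = 0" "b e z = 0" if "e \<in> E" for e
      using ye[OF that] sym[of e y] by (simp_all add: z_def form_simps)
    ultimately have on: "orthonormal (insert z E)"
      using E(2) by (auto simp: orthonormal_def)
    have "z \<in> span (insert x B)"
      using \<open>y \<in> _\<close> by (simp add: z_def span_scale)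
    moreover have "E \<subseteq> span (insert x B)"
      using E(3) \<open>span B \<subseteq> _\<close> span_superset[of E] by auto
    ultimately have 1: "span (insert z E) \<subseteq> span (insert x B)"
      by (intro span_minimal) auto
    have "x = sqrt (b y y) *\<^sub>R z + (\<Sum>e\<in>E. b x e *\<^sub>R e)"
      using pos by (simp add: z_def y_def)
    moreover have "(\<Sum>e\<in>E. b x e *\<^sub>R e) \<in> span (insert z E)"
      using sumE span_mono[of E "insert z E"] by auto
    ultimately have "x \<in> span (insert z E)"
      by (metis insertI1 span_add span_base span_scale)
    moreover have "B \<subseteq> span (insert z E)"
      using E(3) span_mono[of E "insert z E"] span_superset[of B] by auto
    ultimately have "span (insert x B) \<subseteq> span (insert z E)"
      by (intro span_minimal) auto
    then show ?thesis
      using 1 on E(1) by (intro exI[of _ "insert z E"]) auto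
  qed
qed

lemma orthonormal_basis:
  assumes "finite_dim (UNIV :: 'a set)" "subspace S" "pos_def S"
  obtains E where "finite E" "orthonormal E" "span E = S" "card E = dim S"
proof -
  obtain B where "finite B" "span B = S"
    using subspace_basis[OF assms(1,2)] by blast
  then obtain E where "finite E" "orthonormal E" "span E = S"
    using gram_schmidt assms(3) by metis
  then show ?thesis
    using that orthonormal_independent dim_span_eq_card_independent by metis
qed

text \<open>Positive definiteness is required on \<open>S\<close> alone: the form may be indefinite
  on the whole space, and the expansion in an orthonormal basis of \<open>S\<close> still
  projects.\<close>

lemma orthogonal_decomposition:
  assumes "finite_dim (UNIV :: 'a set)" "subspace S" "pos_def S"
  obtains u w where "x = u + w" "u \<in> S" "\<And>y. y \<in> S \<Longrightarrow> b w y = 0"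
proof -
  obtain E where E: "finite E" "orthonormal E" "span E = S"
    using orthonormal_basis[OF assms] by blast
  have "(\<Sum>e\<in>E. b x e *\<^sub>R e) \<in> S"
    using E(3) by (metis (mono_tags, lifting) span_sum span_scale span_base)
  then show ?thesis
    using that[of "\<Sum>e\<in>E. b x e *\<^sub>R e" "x - (\<Sum>e\<in>E. b x e *\<^sub>R e)"]
      orthonormal_projection[OF E(1,2)] E(3) by auto
qed

text \<open>Pairing the difference of two decompositions with a vector of \<open>V i\<close> kills
  all components but the \<open>i\<close>-th, which nondegeneracy then forces to be zero. Asking for
  nondegeneracy instead of definiteness covers a Lorentzian summand.\<close>

lemma orthogonal_sumI:
  assumes I: "finite I" and V: "\<And>i. i \<in> I \<Longrightarrow> subspace (V i)"
    and orth: "\<And>i j x y. i \<in> I \<Longrightarrow> j \<in> I \<Longrightarrow> i \<noteq> j \<Longrightarrow> x \<in> V i \<Longrightarrow> y \<in> V j \<Longrightarrow> b x y = 0"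
    and nondeg: "\<And>i x. i \<in> I \<Longrightarrow> x \<in> V i \<Longrightarrow> (\<And>y. y \<in> V i \<Longrightarrow> b x y = 0) \<Longrightarrow> x = 0"
    and sum: "\<And>x. \<exists>u. (\<forall>i\<in>I. u i \<in> V i) \<and> x = (\<Sum>i\<in>I. u i)"
  shows "orthogonal_sum b I V UNIV"
  unfolding orthogonal_sum_def
proof (intro conjI ballI impI)
  fix x
  obtain u where u: "\<forall>i\<in>I. u i \<in> V i" "x = (\<Sum>i\<in>I. u i)"
    using sum by blast
  \<comment> \<open>Uniqueness is claimed among extensional families, so values outside
    \<open>I\<close> are made \<open>undefined\<close>.\<close>
  have ru: "restrict u I \<in> (\<Pi>\<^sub>E i\<in>I. V i)" "x = (\<Sum>i\<in>I. restrict u I i)"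
    using u by auto
  show "\<exists>!u. u \<in> (\<Pi>\<^sub>E i\<in>I. V i) \<and> x = (\<Sum>i\<in>I. u i)"
  proof (rule ex1I)
    show "restrict u I \<in> (\<Pi>\<^sub>E i\<in>I. V i) \<and> x = (\<Sum>i\<in>I. restrict u I i)"
      using ru by blast
    fix v assume v: "v \<in> (\<Pi>\<^sub>E i\<in>I. V i) \<and> x = (\<Sum>i\<in>I. v i)"
    then have vV: "v i \<in> V i" if "i \<in> I" for i
      using that by (auto simp: PiE_iff)
    show "v = restrict u I"
    proof (rule PiE_ext)
      show "v \<in> (\<Pi>\<^sub>E i\<in>I. V i)" "restrict u I \<in> (\<Pi>\<^sub>E i\<in>I. V i)"
        using v ru by auto
      fix i assume i: "i \<in> I"
      have "v i - u i = 0"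
      proof (rule nondeg[OF i])
        show "v i - u i \<in> V i"
          using V[OF i] vV[OF i] u(1) i by (intro subspace_diff) auto
        fix y assume y: "y \<in> V i"
        have "b (v j - u j) y = 0" if "j \<in> I - {i}" for j
        proof (rule orth)
          show "v j - u j \<in> V j"
            using V vV u(1) that by (intro subspace_diff) auto
        qed (use that i y in auto)
        then have "(\<Sum>j\<in>I - {i}. b (v j - u j) y) = 0"
          by (intro sum.neutral) blast
        then have "b (v i - u i) y = (\<Sum>j\<in>I. b (v j - u j) y)"
          using sum.remove[OF I i, of "\<lambda>j. b (v j - u j) y"] by simp
        also have "\<dots> = b ((\<Sum>j\<in>I. v j) - (\<Sum>j\<in>I. u j)) y"
          by (simp only: sum_left sum_subtractf[symmetric])
        finally show "b (v i - u i) y = 0"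
          using v u(2) by (simp add: form_simps(9))
      qed
      then show "v i = restrict u I i"
        using i by simp
    qed
  qed
qed (use V orth in auto)

text \<open>Being timelike is an open condition, so \<open>x + r *\<^sub>R y\<close> stays in the
  cone for small \<open>r\<close>. Hence \<open>r = 0\<close> is a local minimum of a quadratic
  polynomial whose derivative there is \<open>2 * h x y\<close>.\<close>

lemma stationary:
  assumes "symmetric_form h" "b x x < 0" "h x x = 0"
    and "\<And>r. b (x + r *\<^sub>R y) (x + r *\<^sub>R y) \<le> 0 \<Longrightarrow> h (x + r *\<^sub>R y) (x + r *\<^sub>R y) \<ge> 0"
  shows "h x y = 0"
proof -
  interpret h: symmetric_form h by fact
  define p where "p r = b x x + 2 * r * b x y + r\<^sup>2 * b y y" for r
  define q where "q r = 2 * r * h x y + r\<^sup>2 * h y y" for r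
  have p: "b (x + r *\<^sub>R y) (x + r *\<^sub>R y) = p r" for r
    by (simp add: form_simps p_def sym[of y x] power2_eq_square algebra_simps)
  have q: "h (x + r *\<^sub>R y) (x + r *\<^sub>R y) = q r" for r
    by (simp add: h.form_simps q_def h.sym[of y x] assms(3) power2_eq_square algebra_simps)
  have "(p \<longlongrightarrow> p 0) (at 0)"
    unfolding p_def by (intro tendsto_intros)
  then have "\<forall>\<^sub>F r in at 0. p r < 0"
    using order_tendstoD(2)[of p "p 0" "at 0" 0] assms(2) by (simp add: p_def)
  then obtain d where d: "d > 0" "\<And>r. r \<noteq> 0 \<Longrightarrow> dist r 0 < d \<Longrightarrow> p r < 0"
    by (auto simp: eventually_at)
  have "q 0 \<le> q r" if "\<bar>0 - r\<bar> < d" for r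
    using assms(4)[of r] d(2)[of r] that p[of r] q[of r] by (cases "r = 0") (auto simp: q_def)
  moreover have "(q has_real_derivative 2 * h x y) (at 0)"
    unfolding q_def by (auto intro!: derivative_eq_intros)
  ultimately have "2 * h x y = 0"
    using DERIV_local_min[of q "2 * h x y" 0 d] d(1) by blast
  then show ?thesis
    by simp
qed

end

section \<open>Eigenvectors from a maximum over a compact set\<close>

lemma continuous_form:
  assumes "symmetric_form b" "finite E"
  shows "continuous_on UNIV (\<lambda>u. b (\<Sum>e\<in>E. u e *\<^sub>R e) (\<Sum>e\<in>E. u e *\<^sub>R e))"
proof -
  interpret symmetric_form b by fact
  have "continuous_on UNIV (\<lambda>u. \<Sum>e\<in>E. u e * (\<Sum>f\<in>E. u f * b e f))"
    by (intro continuous_on_sum continuous_on_mult continuous_on_const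
        continuous_on_product_coordinates)
  also have "(\<lambda>u. \<Sum>e\<in>E. u e * (\<Sum>f\<in>E. u f * b e f)) =
      (\<lambda>u. b (\<Sum>e\<in>E. u e *\<^sub>R e) (\<Sum>e\<in>E. u e *\<^sub>R e))"
  proof
    fix u
    have "b (\<Sum>e\<in>E. u e *\<^sub>R e) (\<Sum>e\<in>E. u e *\<^sub>R e) = (\<Sum>e\<in>E. b (u e *\<^sub>R e) (\<Sum>f\<in>E. u f *\<^sub>R f))"
      by (rule sum_left)
    also have "\<dots> = (\<Sum>e\<in>E. u e * (\<Sum>f\<in>E. u f * b e f))"
      by (simp add: sum_right form_simps sum_distrib_left mult.left_commute)
    finally show "(\<Sum>e\<in>E. u e * (\<Sum>f\<in>E. u f * b e f)) =
        b (\<Sum>e\<in>E. u e *\<^sub>R e) (\<Sum>e\<in>E. u e *\<^sub>R e)" by simp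
  qed
  finally show ?thesis .
qed

text \<open>
  The eigenvector maximises \<open>- b y y / Q y y\<close> over the compact set of all \<open>y\<close> of
  \<open>g\<close>-norm one with \<open>b y y \<le> 0\<close>.
\<close>
lemma pencil_eigenvector:
  fixes b g Q :: "'a::real_vector \<Rightarrow> 'a \<Rightarrow> real"
  assumes "finite_dim (UNIV :: 'a set)" "subspace S"
    and "symmetric_form g" "symmetric_form b" "symmetric_form Q"
    and pos: "\<And>y. y \<in> S \<Longrightarrow> y \<noteq> 0 \<Longrightarrow> g y y > 0"
    and Qpos: "\<And>y. y \<in> S \<Longrightarrow> y \<noteq> 0 \<Longrightarrow> b y y \<le> 0 \<Longrightarrow> Q y y > 0"
    and t: "t \<in> S" "b t t < 0"
  obtains x m where "x \<in> S" "b x x < 0" "\<And>y. y \<in> S \<Longrightarrow> b x y = - m * Q x y"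
proof -
  interpret g: symmetric_form g by fact
  interpret b: symmetric_form b by fact
  interpret Q: symmetric_form Q by fact
  have "g.pos_def S"
    using pos by (auto simp: g.pos_def_def)
  then obtain E where E: "finite E" "g.orthonormal E" "span E = S"
    using g.orthonormal_basis[OF assms(1,2)] by blast
  define ev where "ev u = (\<Sum>e\<in>E. u e *\<^sub>R e)" for u
  \<comment> \<open>A \<open>g\<close>-unit vector has coordinates of modulus at most one. Pinning
    all coordinates outside \<open>E\<close> to zero makes this a product of compact sets over the
    whole index type.\<close>
  define box where "box = (PiE UNIV (\<lambda>e. if e \<in> E then {-1..1} else {0}) :: ('a \<Rightarrow> real) set)"
  have evS: "ev u \<in> S" for u
    unfolding ev_def E(3)[symmetric] by (meson span_sum span_scale span_base)
  have gev: "g (ev u) (ev u) = (\<Sum>e\<in>E. (u e)\<^sup>2)" for u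
    unfolding ev_def g.orthonormal_parseval[OF E(1,2)] by (simp add: power2_eq_square)
  have "compactin (product_topology (\<lambda>_. euclidean) UNIV) box"
    unfolding box_def compactin_PiE by auto
  then have "compact box"
    by (simp add: euclidean_product_topology)
  moreover have "closed {u. g (ev u) (ev u) = 1}"
    unfolding ev_def using continuous_form[OF assms(3) E(1)]
    by (intro closed_Collect_eq) auto
  moreover have "closed {u. b (ev u) (ev u) \<le> 0}"
    unfolding ev_def using continuous_form[OF assms(4) E(1)]
    by (intro closed_Collect_le) auto
  ultimately have comp: "compact (box \<inter> {u. g (ev u) (ev u) = 1} \<inter> {u. b (ev u) (ev u) \<le> 0})"
    (is "compact ?K") by (simp add: compact_Int_closed)
  have coord: "\<exists>u\<in>?K. \<exists>c>0. ev u = c *\<^sub>R y" if y: "y \<in> S" "y \<noteq> 0" "b y y \<le> 0" for y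
  proof -
    define c where "c = 1 / sqrt (g y y)"
    have c: "c > 0" "g (c *\<^sub>R y) (c *\<^sub>R y) = 1"
      using pos[OF y(1,2)] by (simp_all add: c_def g.form_simps field_simps)
    define u where "u e = (if e \<in> E then g (c *\<^sub>R y) e else 0)" for e
    have "c *\<^sub>R y \<in> span E"
      using y E(3) by (metis span_scale)
    then have "c *\<^sub>R y = (\<Sum>e\<in>E. g (c *\<^sub>R y) e *\<^sub>R e)"
      by (rule g.orthonormal_expansion[OF E(1,2)])
    then have ev: "ev u = c *\<^sub>R y"
      by (simp add: ev_def u_def)
    then have one: "(\<Sum>e\<in>E. (u e)\<^sup>2) = 1"
      using gev[of u] c by simp
    have "(u e)\<^sup>2 \<le> 1" if "e \<in> E" for e
      using member_le_sum[of e E "\<lambda>e. (u e)\<^sup>2"] that E(1) one by simp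
    then have "\<bar>u e\<bar> \<le> 1" if "e \<in> E" for e
      using that by (simp add: abs_square_le_1)
    then have "u \<in> box"
      by (auto simp: box_def u_def abs_le_iff minus_le_iff)
    moreover have "b (ev u) (ev u) \<le> 0"
      using y(3) c(1) by (simp add: ev b.form_simps mult_nonneg_nonpos)
    ultimately show ?thesis
      using c ev by (intro bexI[of _ u]) auto
  qed
  have ev0: "ev u \<noteq> 0" if "u \<in> ?K" for u
    using that by (auto simp: g.form_simps)
  have cont: "continuous_on ?K (\<lambda>u. - b (ev u) (ev u) / Q (ev u) (ev u))"
  proof (intro continuous_on_divide continuous_on_minus)
    show "continuous_on ?K (\<lambda>u. b (ev u) (ev u))" "continuous_on ?K (\<lambda>u. Q (ev u) (ev u))"
      unfolding ev_def using continuous_form[OF assms(4) E(1)] continuous_form[OF assms(5) E(1)]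
      by (auto intro: continuous_on_subset)
    show "\<forall>u\<in>?K. Q (ev u) (ev u) \<noteq> 0"
      using Qpos[OF evS ev0] by force
  qed
  have "t \<noteq> 0"
    using t(2) by (auto simp: b.form_simps)
  then obtain v c where v: "v \<in> ?K" "c > 0" "ev v = c *\<^sub>R t"
    using coord[of t] t by force
  then obtain u where u: "u \<in> ?K"
    and max: "\<And>w. w \<in> ?K \<Longrightarrow> - b (ev w) (ev w) / Q (ev w) (ev w) \<le> - b (ev u) (ev u) / Q (ev u) (ev u)"
    using continuous_attains_sup[OF comp _ cont] by blast
  define m where "m = - b (ev u) (ev u) / Q (ev u) (ev u)"
  have Qu: "Q (ev u) (ev u) > 0"
    using Qpos[OF evS ev0[OF u]] u by auto
  have Qv: "Q (ev v) (ev v) > 0"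
    using Qpos[OF evS ev0[OF v(1)]] v by auto
  have "b (ev v) (ev v) < 0"
    using v t by (simp add: b.form_simps mult_pos_neg)
  then have "0 < - b (ev v) (ev v) / Q (ev v) (ev v)"
    using Qv by (intro divide_pos_pos) auto
  \<comment> \<open>The competitor \<open>t\<close> gives a positive value while lightlike vectors
    give zero, so the maximum is attained at a strictly timelike vector.\<close>
  then have m: "m > 0"
    using max[OF v(1)] by (simp add: m_def)
  then have neg: "b (ev u) (ev u) < 0"
    using Qu by (simp add: m_def divide_less_0_iff)
  \<comment> \<open>Maximality of \<open>m\<close> says that \<open>h\<close> is nonnegative on the
    cone, with value zero at the maximiser: the situation of \<open>stationary\<close>.\<close>
  define h where "h x y = b x y + m * Q x y" for x y
  have h: "symmetric_form h"
    using b.sym Q.sym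
    by unfold_locales (auto simp: h_def bilinear_def linear_iff b.form_simps Q.form_simps algebra_simps)
  interpret h: symmetric_form h by fact
  have hnn: "h y y \<ge> 0" if y: "y \<in> S" "b y y \<le> 0" for y
  proof (cases "y = 0")
    case False
    then obtain w c where w: "w \<in> ?K" "c > 0" "ev w = c *\<^sub>R y"
      using coord[of y] y by force
    have "Q (ev w) (ev w) > 0"
      using Qpos[OF evS ev0[OF w(1)]] w by auto
    then have "- b (ev w) (ev w) \<le> m * Q (ev w) (ev w)"
      using max[OF w(1)] by (simp only: m_def pos_divide_le_eq)
    then have "h (ev w) (ev w) \<ge> 0"
      by (simp add: h_def)
    then have "c * (c * h y y) \<ge> 0"
      by (simp add: w h.form_simps)
    then show ?thesis
      using w(2) by (simp add: zero_le_mult_iff)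
  qed (simp add: h.form_simps)
  have "h (ev u) y = 0" if "y \<in> S" for y
  proof (rule b.stationary[OF h neg])
    show "h (ev u) (ev u) = 0"
      using Qu by (simp add: h_def m_def)
  next
    fix r assume "b (ev u + r *\<^sub>R y) (ev u + r *\<^sub>R y) \<le> 0"
    then show "h (ev u + r *\<^sub>R y) (ev u + r *\<^sub>R y) \<ge> 0"
      using hnn evS that assms(2) by (simp add: subspace_add subspace_scale)
  qed
  then have "b (ev u) y = - m * Q (ev u) y" if "y \<in> S" for y
    using that by (fastforce simp: h_def)
  then show ?thesis
    by (rule that[OF evS neg])
qed

lemma symmetric_eigenvector:
  fixes g q :: "'a::real_vector \<Rightarrow> 'a \<Rightarrow> real"
  assumes "finite_dim (UNIV :: 'a set)" "subspace S" "S \<noteq> {0}"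
    and "symmetric_form g" "symmetric_form q"
    and pos: "\<And>y. y \<in> S \<Longrightarrow> y \<noteq> 0 \<Longrightarrow> g y y > 0"
  obtains x m where "x \<in> S" "x \<noteq> 0" "\<And>y. y \<in> S \<Longrightarrow> q x y = m * g x y"
proof -
  interpret g: symmetric_form g by fact
  interpret q: symmetric_form q by fact
  obtain t where t: "t \<in> S" "t \<noteq> 0"
    using assms(2,3) subspace_0 by blast
  \<comment> \<open>One more than the Rayleigh quotient at \<open>t\<close>, so that
    \<open>b t t = - g t t < 0\<close> for the shifted form; an eigenvector of the shift is one of
    \<open>q\<close>.\<close>
  define M where "M = q t t / g t t + 1"
  define b where "b x y = q x y - M * g x y" for x y
  have b: "symmetric_form b"
    using q.sym g.sym
    by unfold_locales (auto simp: b_def bilinear_def linear_iff q.form_simps g.form_simps algebra_simps)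
  have "b t t < 0"
    using pos[OF t] by (simp add: b_def M_def field_simps)
  then obtain x m where x: "x \<in> S" "b x x < 0" "\<And>y. y \<in> S \<Longrightarrow> b x y = - m * g x y"
    using pencil_eigenvector[OF assms(1,2,4) b assms(4) pos pos t(1)] by blast
  have "x \<noteq> 0"
    using x(2) by (auto simp: b_def g.form_simps q.form_simps)
  then show ?thesis
    using that[of x "M - m"] x by (auto simp: b_def algebra_simps)
qed

section \<open>Lorentzian forms\<close>

text \<open>Dimensions of subspaces of \<open>S\<close> are bounded by \<open>dim S\<close>, and the
  zero subspace is negative definite, so the \<open>Max\<close> is over a finite nonempty
  set.\<close>

lemma metric_index_props:
  fixes b :: "'a::real_vector \<Rightarrow> 'a \<Rightarrow> real"
  assumes "finite_dim (UNIV :: 'a set)" "subspace S"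
  shows metric_index_ge: "\<And>U. subspace U \<Longrightarrow> U \<subseteq> S \<Longrightarrow> (\<And>x. x \<in> U \<Longrightarrow> x \<noteq> 0 \<Longrightarrow> b x x < 0) \<Longrightarrow>
      dim U \<le> metric_index S b"
    and metric_index_attained: "\<exists>U. subspace U \<and> U \<subseteq> S \<and> (\<forall>x\<in>U. x \<noteq> 0 \<longrightarrow> b x x < 0) \<and>
      dim U = metric_index S b"
proof -
  let ?D = "{dim U |U. subspace U \<and> U \<subseteq> S \<and> (\<forall>x\<in>U. x \<noteq> 0 \<longrightarrow> b x x < 0)}"
  have "?D \<subseteq> {..dim S}"
    using subspace_dim_mono[OF assms(1) _ assms(2)] by auto
  then have fin: "finite ?D"
    by (rule finite_subset) simp
  show "dim U \<le> metric_index S b"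
    if "subspace U" "U \<subseteq> S" "\<And>x. x \<in> U \<Longrightarrow> x \<noteq> 0 \<Longrightarrow> b x x < 0" for U
    unfolding metric_index_def using that by (intro Max_ge[OF fin]) blast
  have "subspace {0 :: 'a}" "{0} \<subseteq> S"
    using assms(2) by (auto simp: subspace_0)
  then have "?D \<noteq> {}"
    by blast
  from Max_in[OF fin this] show "\<exists>U. subspace U \<and> U \<subseteq> S \<and> (\<forall>x\<in>U. x \<noteq> 0 \<longrightarrow> b x x < 0) \<and>
      dim U = metric_index S b"
    unfolding metric_index_def by auto
qed

lemma span_pair:
  "x \<in> span {e, f} \<longleftrightarrow> (\<exists>r s. x = r *\<^sub>R e + s *\<^sub>R f)"
  by (auto simp: span_insert span_singleton algebra_simps diff_eq_eq)

lemma dim_pair: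
  assumes "e \<noteq> 0" "f \<notin> span {e}"
  shows "dim (span {e, f}) = 2"
proof -
  have "independent {f, e}" "e \<noteq> f"
    using assms span_base[of f "{e}"] by (auto simp: independent_insert)
  then show ?thesis
    by (simp add: insert_commute dim_eq_card_independent)
qed

lemma dim_line:
  assumes "e \<noteq> 0"
  shows "dim (span {e}) = 1"
  using assms by (simp add: dim_eq_card_independent)

lemma dim_zero: "dim {0 :: 'a::real_vector} = 0"
  using dim_span_eq_card_independent[of "{} :: 'a set"] by (simp add: independent_empty)

locale lorentzian_form = symmetric_form b for b :: "'a::real_vector \<Rightarrow> 'a \<Rightarrow> real" +
  assumes fin_dim: "finite_dim (UNIV :: 'a set)"
    and nondegenerate: "(\<And>y. b x y = 0) \<Longrightarrow> x = 0"
    and index_one: "metric_index UNIV b = 1"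
begin

lemma timelike_exists: obtains t where "b t t < 0"
proof -
  obtain U where U: "subspace U" "\<forall>x\<in>U. x \<noteq> 0 \<longrightarrow> b x x < 0" "dim U = 1"
    using metric_index_attained[OF fin_dim subspace_UNIV, of b] index_one by auto
  then have "U \<noteq> {0}"
    by (auto simp: dim_zero)
  then obtain x where "x \<in> U" "x \<noteq> 0"
    using U(1) subspace_0 by blast
  then show ?thesis
    using U(2) that by blast
qed

text \<open>Otherwise \<open>t\<close> and \<open>x\<close> would span a negative definite plane,
  against index one.\<close>

lemma orthogonal_timelike_nonneg:
  assumes t: "b t t < 0" and x: "b x t = 0"
  shows "b x x \<ge> 0"
proof (rule ccontr)
  assume "\<not> b x x \<ge> 0"
  then have neg: "b x x < 0"
    by simp
  have "t \<noteq> 0"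
    using t by (auto simp: form_simps)
  moreover have "x \<notin> span {t}"
  proof
    assume "x \<in> span {t}"
    then obtain r where "x = r *\<^sub>R t"
      by (auto simp: span_singleton)
    then show False
      using neg x t by (auto simp: form_simps)
  qed
  ultimately have "dim (span {t, x}) = 2"
    by (rule dim_pair)
  moreover have "b z z < 0" if z: "z \<in> span {t, x}" "z \<noteq> 0" for z
  proof -
    obtain r s where rs: "z = r *\<^sub>R t + s *\<^sub>R x"
      using z(1) unfolding span_pair by blast
    have "b z z = r\<^sup>2 * b t t + s\<^sup>2 * b x x"
      by (simp add: rs form_simps x sym[of t x] power2_eq_square)
    moreover have "r\<^sup>2 * b t t \<le> 0" "s\<^sup>2 * b x x \<le> 0"
      using t neg by (simp_all add: mult_nonneg_nonpos)
    moreover have "r\<^sup>2 * b t t < 0 \<or> s\<^sup>2 * b x x < 0"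
      using z(2) t neg by (auto simp: rs mult_less_0_iff)
    ultimately show ?thesis
      by linarith
  qed
  ultimately show False
    using metric_index_ge[OF fin_dim subspace_UNIV, of "span {t, x}" b] index_one by auto
qed

text \<open>A nonzero null \<open>x\<close> orthogonal to \<open>t\<close> pairs nontrivially with
  some \<open>z\<close> orthogonal to \<open>t\<close>. The square of
  \<open>z + s *\<^sub>R x\<close> is then a nonconstant affine function of \<open>s\<close>, hence
  negative somewhere.\<close>

lemma orthogonal_timelike_pos:
  assumes t: "b t t < 0" and x: "b x t = 0" "x \<noteq> 0"
  shows "b x x > 0"
proof (rule ccontr)
  assume "\<not> b x x > 0"
  then have null: "b x x = 0"
    using orthogonal_timelike_nonneg[OF t x(1)] by simp
  obtain y where y: "b x y \<noteq> 0"
    using nondegenerate x(2) by blast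
  define z where "z = y - (b y t / b t t) *\<^sub>R t"
  \<comment> \<open>Chosen so that \<open>z + s *\<^sub>R x\<close> has square exactly -1.\<close>
  define s where "s = - (b z z + 1) / (2 * b x z)"
  have z: "b z t = 0" "b x z \<noteq> 0"
    using t x(1) y by (simp_all add: z_def form_simps)
  then have "b (z + s *\<^sub>R x) t = 0"
    using x(1) by (simp add: form_simps)
  then have "b (z + s *\<^sub>R x) (z + s *\<^sub>R x) \<ge> 0"
    by (rule orthogonal_timelike_nonneg[OF t])
  moreover have "b (z + s *\<^sub>R x) (z + s *\<^sub>R x) = b z z + 2 * (s * b x z)"
    by (simp add: form_simps null sym[of z x])
  moreover have "2 * (s * b x z) = - (b z z + 1)"
    using z(2) by (simp add: s_def)
  ultimately show False
    by simp
qed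

text \<open>A timelike \<open>x\<close> would make \<open>e\<close> spacelike. For null
  \<open>x\<close>, subtracting the multiple of \<open>e\<close> that makes it orthogonal to a
  timelike vector leaves a null vector in a positive definite space, that is, zero.\<close>

lemma orthogonal_lightlike:
  assumes e: "lightlike b e" and x: "b x e = 0"
  shows orthogonal_lightlike_nonneg: "b x x \<ge> 0"
    and orthogonal_lightlike_null: "b x x = 0 \<Longrightarrow> x \<in> span {e}"
proof -
  have e': "e \<noteq> 0" "b e e = 0"
    using e by (auto simp: lightlike_def)
  show "b x x \<ge> 0"
  proof (rule ccontr)
    assume "\<not> b x x \<ge> 0"
    then show False
      using orthogonal_timelike_pos[of x e] x sym[of e x] e' by auto
  qed
  assume null: "b x x = 0"
  obtain t where t: "b t t < 0"
    by (rule timelike_exists)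
  then have et: "b e t \<noteq> 0"
    using orthogonal_timelike_pos[of t e] e' by auto
  define z where "z = x - (b x t / b e t) *\<^sub>R e"
  have "b z t = 0" "b z z = 0"
    using et x null e' by (simp_all add: z_def form_simps sym[of e x])
  then have "z = 0"
    using orthogonal_timelike_pos[OF t] by force
  then show "x \<in> span {e}"
    by (auto simp: z_def span_singleton)
qed

text \<open>The plane contains the timelike vector \<open>e - f / b e f\<close>.\<close>
lemma hyperbolic_plane:
  assumes e: "lightlike b e" and f: "lightlike b f" and ef: "b e f \<noteq> 0"
  shows "lorentzian_on (span {e, f}) b" "dim (span {e, f}) = 2"
    and "\<exists>t\<in>span {e, f}. b t t < 0"
proof -
  have e': "e \<noteq> 0" "b e e = 0" and f': "f \<noteq> 0" "b f f = 0"
    using e f by (auto simp: lightlike_def)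
  have "f \<notin> span {e}"
    using ef e' by (auto simp: span_singleton form_simps)
  then show dim2: "dim (span {e, f}) = 2"
    using e' by (intro dim_pair)
  define t where "t = e - (1 / b e f) *\<^sub>R f"
  have t: "b t t = -2"
    using ef by (simp add: t_def form_simps e' f' sym[of f e])
  have tin: "t \<in> span {e, f}"
    by (simp add: t_def span_base span_diff span_scale)
  show "\<exists>t\<in>span {e, f}. b t t < 0"
    using t tin by (intro bexI[of _ t]) auto
  have neg: "b x x < 0" if x: "x \<in> span {t}" "x \<noteq> 0" for x
  proof -
    obtain r where r: "x = r *\<^sub>R t"
      using x(1) by (auto simp: span_singleton)
    with x(2) have "r \<noteq> 0"
      by auto
    then show ?thesis
      using t r by (auto simp: form_simps zero_less_mult_iff)
  qed
  have "t \<noteq> 0"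
    using t by (auto simp: form_simps)
  then have "1 \<le> metric_index (span {e, f}) b"
    using metric_index_ge[OF fin_dim subspace_span, of "span {t}" "{e, f}" b] neg tin
    by (simp add: dim_line span_minimal del: dim_span)
  moreover have "metric_index (span {e, f}) b \<le> 1"
  proof (rule ccontr)
    assume "\<not> ?thesis"
    then obtain U where U: "subspace U" "U \<subseteq> span {e, f}" "\<forall>x\<in>U. x \<noteq> 0 \<longrightarrow> b x x < 0" "dim U \<ge> 2"
      using metric_index_attained[OF fin_dim subspace_span, of "{e, f}" b] by auto
    \<comment> \<open>A negative definite subspace of dimension two would fill the plane, which
      contains the null vector \<open>e\<close>.\<close>
    then have "U = span {e, f}"
      using subspace_dim_strict_mono[OF fin_dim U(1) subspace_span, of "{e, f}"] dim2 by auto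
    then have "e \<in> U"
      by (simp add: span_base)
    then show False
      using U(3) e' by auto
  qed
  moreover have "metric_on (span {e, f}) b"
    unfolding metric_on_def
  proof (intro conjI ballI impI allI)
    fix x assume x: "x \<in> span {e, f}" "\<forall>y\<in>span {e, f}. b x y = 0"
    obtain r s where rs: "x = r *\<^sub>R e + s *\<^sub>R f"
      using x(1) unfolding span_pair by blast
    have "b x e = 0" "b x f = 0"
      using x(2) by (auto simp: span_base)
    then show "x = 0"
      using ef by (simp add: rs form_simps e' f' sym[of f e])
  qed (use bilinear sym in auto)
  moreover have "finite_dim (span {e, f})"
    unfolding finite_dim_def by (intro exI[of _ "{e, f}"]) auto
  ultimately show "lorentzian_on (span {e, f}) b"
    by (simp add: lorentzian_on_def)
qed

end

lemma lorentzian_form_if_lorentzian_on: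
  "lorentzian_on UNIV b \<Longrightarrow> lorentzian_form b"
  by unfold_locales (auto simp: lorentzian_on_def metric_on_def)

section \<open>Complex structures on Euclidean spaces\<close>

context symmetric_form
begin

lemma pos_def_orthogonal_eqI:
  assumes "subspace S" "pos_def S" "x \<in> S" "y \<in> S" "\<And>z. z \<in> S \<Longrightarrow> b x z = b y z"
  shows "x = y"
proof -
  have "x - y \<in> S"
    using assms by (simp add: subspace_diff)
  moreover from this have "b (x - y) (x - y) = 0"
    using assms(5)[of "x - y"] by (simp add: form_simps(3))
  ultimately show ?thesis
    using assms(2) by (auto simp: pos_def_def)
qed

text \<open>A unit vector \<open>x\<close> and \<open>J x\<close> are orthonormal and span a
  \<open>J\<close>-invariant plane. By skewness its complement \<open>W\<close> is again
  \<open>J\<close>-invariant, and induction removes two dimensions at a time.\<close>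

lemma complex_structure_dim_even:
  assumes "finite_dim (UNIV :: 'a set)" "subspace S" "pos_def S"
    and "J \<in> so_on S b" "\<And>x. x \<in> S \<Longrightarrow> J (J x) = - x"
  shows "even (dim S)"
  using assms(2-)
proof (induction "dim S" arbitrary: S rule: less_induct)
  case less
  note S = less.prems(1,2) and JJ = less.prems(4)
  have JS: "J x \<in> S" if "x \<in> S" for x
    using less.prems(3) that by (auto simp: so_on_def)
  have skew: "b (J x) y = - b x (J y)" if "x \<in> S" "y \<in> S" for x y
    using less.prems(3) that by (auto simp: so_on_def)
  show ?case
  proof (cases "S = {0}")
    case True
    then show ?thesis
      by (simp add: dim_zero)
  next
    case False
    then obtain x0 where x0: "x0 \<in> S" "x0 \<noteq> 0"
      using S(1) subspace_0 by blast
    define x where "x = (1 / sqrt (b x0 x0)) *\<^sub>R x0"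
    have "b x0 x0 > 0"
      using x0 S(2) by (auto simp: pos_def_def)
    then have x: "x \<in> S" "b x x = 1"
      using x0(1) S(1) by (simp_all add: x_def form_simps subspace_scale)
    have Jx: "J x \<in> S" "b (J x) (J x) = 1" "b x (J x) = 0" "b (J x) x = 0"
      using JS[OF x(1)] skew[OF x(1) JS[OF x(1)]] skew[OF x(1) x(1)] JJ[OF x(1)] x(2) sym[of x "J x"]
      by (simp_all add: form_simps)
    define W where "W = {y \<in> S. b y x = 0 \<and> b y (J x) = 0}"
    have W: "subspace W" "W \<subseteq> S"
      using S(1) by (auto simp: W_def subspace_def form_simps)
    have "x \<notin> W"
      using x by (simp add: W_def)
    then have "W \<subset> S"
      using W x by auto
    then have smaller: "dim W < dim S"
      by (rule subspace_dim_strict_mono[OF assms(1) W(1) S(1)])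
    have posW: "pos_def W"
      using S(2) W(2) by (auto simp: pos_def_def)
    have "J y \<in> W" if "y \<in> W" for y
      using that JS skew[of y x] skew[of y "J x"] JJ[OF x(1)] x(1) Jx(1)
      by (simp add: W_def form_simps)
    then have "J \<in> so_on W b"
      using less.prems(3) W(2) unfolding so_on_def by blast
    then have evenW: "even (dim W)"
      using less.hyps[OF smaller W(1) posW] JJ W(2) by blast
    obtain F where F: "finite F" "orthonormal F" "span F = W" "card F = dim W"
      using orthonormal_basis[OF assms(1) W(1) posW] by blast
    have FW: "f \<in> W" if "f \<in> F" for f
      using F(3) that span_base by blast
    have "x \<notin> F" "J x \<notin> F" "x \<noteq> J x"
      using FW[of x] FW[of "J x"] x(2) Jx by (auto simp: W_def)
    then have card: "card (insert x (insert (J x) F)) = dim W + 2"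
      using F by simp
    have "b f x = 0" "b x f = 0" "b f (J x) = 0" "b (J x) f = 0" if "f \<in> F" for f
      using FW[OF that] sym[of x f] sym[of "J x" f] by (auto simp: W_def)
    then have on: "orthonormal (insert x (insert (J x) F))"
      using F(2) x(2) Jx \<open>x \<noteq> J x\<close> by (auto simp: orthonormal_def)
    have "span (insert x (insert (J x) F)) = S"
    proof
      show "span (insert x (insert (J x) F)) \<subseteq> S"
        using x Jx FW W(2) S(1) by (intro span_minimal) auto
      show "S \<subseteq> span (insert x (insert (J x) F))"
      proof
        fix y assume y: "y \<in> S"
        define w where "w = y - b y x *\<^sub>R x - b y (J x) *\<^sub>R J x"
        have "w \<in> W"
          using y x Jx S(1) by (simp add: W_def w_def form_simps subspace_diff subspace_scale)
        then have "w \<in> span (insert x (insert (J x) F))"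
          using F(3) span_mono[of F "insert x (insert (J x) F)"] by auto
        moreover have "y = w + b y x *\<^sub>R x + b y (J x) *\<^sub>R J x"
          by (simp add: w_def)
        ultimately show "y \<in> span (insert x (insert (J x) F))"
          by (metis insertI1 insertI2 span_add span_base span_scale)
      qed
    qed
    then have "dim S = dim W + 2"
      using card orthonormal_independent[OF _ on] F(1) dim_span_eq_card_independent by fastforce
    then show ?thesis
      using evenW by simp
  qed
qed

text \<open>Half of an orthonormal basis is matched with the other half, and \<open>J\<close> is the
  quarter turn sending \<open>a\<close> to \<open>h a\<close> and \<open>h a\<close> to
  \<open>- a\<close>. This serves the even-dimensional summands on which the centre acts by
  zero.\<close>

lemma complex_structure_exists:
  assumes "finite_dim (UNIV :: 'a set)" "subspace S" "pos_def S" "even (dim S)"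
  shows "\<exists>J\<in>so_on S b. \<forall>x\<in>S. J (J x) = - x"
proof -
  obtain E where E: "finite E" "orthonormal E" "span E = S" "card E = dim S"
    using orthonormal_basis[OF assms(1-3)] by blast
  obtain A where A: "A \<subseteq> E" "card A = dim S div 2" "finite A"
    using obtain_subset_with_card_n[of "dim S div 2" E] E by auto
  have "card (E - A) = card A"
    using A E assms(4) by (auto simp: card_Diff_subset)
  then obtain h where h: "bij_betw h A (E - A)"
    using finite_same_card_bij[of A "E - A"] A E by auto
  then have hA: "h a \<in> E" "h a \<notin> A" if "a \<in> A" for a
    using that by (auto simp: bij_betw_def)
  define J where "J x = (\<Sum>a\<in>A. b x a *\<^sub>R h a - b x (h a) *\<^sub>R a)" for x
  have JS: "J x \<in> S" for x
  proof -
    have "b x a *\<^sub>R h a - b x (h a) *\<^sub>R a \<in> span E" if "a \<in> A" for a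
      using that hA A by (intro span_diff span_scale span_base) auto
    then show ?thesis
      unfolding J_def E(3)[symmetric] by (intro span_sum)
  qed
  have add: "J (x + y) = J x + J y" for x y
    by (simp add: J_def form_simps algebra_simps sum.distrib sum_subtractf)
  have scale: "J (r *\<^sub>R x) = r *\<^sub>R J x" for r x
    by (simp add: J_def form_simps algebra_simps scaleR_sum_right)
  have bJ: "b (J x) y = (\<Sum>a\<in>A. b x a * b (h a) y - b x (h a) * b a y)" for x y
    by (simp add: J_def sum_left form_simps)
  have skew: "b (J x) y = - b x (J y)" for x y
  proof -
    have "b x (J y) = b (J y) x"
      by (rule sym)
    also have "\<dots> = - (\<Sum>a\<in>A. b x a * b (h a) y - b x (h a) * b a y)"
      unfolding bJ sum_negf[symmetric]
      by (intro sum.cong) (auto simp: sym[of _ x] sym[of _ y] algebra_simps)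
    finally show ?thesis
      by (simp add: bJ)
  qed
  have Jh: "b (J x) (h a) = b x a" and Ja: "b (J x) a = - b x (h a)" if a: "a \<in> A" for x a
  proof -
    have "b (h c) (h a) = (if c = a then 1 else 0)" "b c (h a) = 0"
      "b c a = (if c = a then 1 else 0)" "b (h c) a = 0" if "c \<in> A" for c
      using that a hA[OF a] hA[OF that] A subsetD[OF A(1) a] subsetD[OF A(1) that] h E(2)
      by (auto simp: orthonormal_def bij_betw_def inj_on_def)
    then have "b (J x) (h a) = (\<Sum>c\<in>A. if c = a then b x c else 0)"
      and "b (J x) a = (\<Sum>c\<in>A. if c = a then - b x (h c) else 0)"
      unfolding bJ by (auto intro!: sum.cong)
    then show "b (J x) (h a) = b x a" "b (J x) a = - b x (h a)"
      using a A by simp_all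
  qed
  have "J (J x) = - x" if x: "x \<in> S" for x
  proof -
    have "b (J (J x)) e = b (- x) e" if "e \<in> E" for e
    proof (cases "e \<in> A")
      case True
      then show ?thesis
        by (simp add: Ja Jh form_simps)
    next
      case False
      with that have "e \<in> h ` A"
        using h by (simp add: bij_betw_def)
      then obtain a where "a \<in> A" "e = h a"
        by blast
      then show ?thesis
        by (simp add: Ja Jh form_simps)
    qed
    then have "(\<Sum>e\<in>E. b (J (J x)) e *\<^sub>R e) = (\<Sum>e\<in>E. b (- x) e *\<^sub>R e)"
      by simp
    moreover have "J (J x) \<in> span E" "- x \<in> span E"
      using JS x E(3) by (auto simp: span_neg)
    ultimately show ?thesis
      using orthonormal_expansion[OF E(1,2)] by metis
  qed
  moreover have "J \<in> so_on S b"
    using JS add scale skew by (auto simp: so_on_def)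
  ultimately show ?thesis
    by blast
qed

end

section \<open>Orthogonal representations\<close>

locale skew_representation = symmetric_form b
  for b :: "'v::real_vector \<Rightarrow> 'v \<Rightarrow> real" +
  fixes \<rho> :: "'g::real_vector \<Rightarrow> 'v \<Rightarrow> 'v"
  assumes fin_dim: "finite_dim (UNIV :: 'v set)"
    and rho_bilinear: "bilinear \<rho>"
    and rho_skew: "b (\<rho> Z x) y = - b x (\<rho> Z y)"
begin

lemma rho_simps:
  "\<rho> Z (x + y) = \<rho> Z x + \<rho> Z y" "\<rho> Z (x - y) = \<rho> Z x - \<rho> Z y"
  "\<rho> Z (r *\<^sub>R x) = r *\<^sub>R \<rho> Z x" "\<rho> Z (- x) = - \<rho> Z x" "\<rho> Z 0 = 0"
  using bilinear_radd[OF rho_bilinear] bilinear_rsub[OF rho_bilinear]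
    bilinear_rmul[OF rho_bilinear] bilinear_rneg[OF rho_bilinear] bilinear_rzero[OF rho_bilinear]
  by simp_all

lemma invariant_orthogonal:
  assumes "invariant_subspace \<rho> W" "invariant_subspace \<rho> U"
  shows "invariant_subspace \<rho> {x \<in> W. \<forall>u\<in>U. b x u = 0}"
  using assms by (auto simp: invariant_subspace_def subspace_def form_simps rho_skew)

lemma irreducible_line:
  assumes "x \<noteq> 0" and "\<And>Z. \<rho> Z x \<in> span {x}"
  shows "irreducible_subspace \<rho> (span {x})"
  unfolding irreducible_subspace_def
proof (intro conjI allI impI)
  have "\<rho> Z y \<in> span {x}" if y: "y \<in> span {x}" for Z y
  proof -
    obtain r where "y = r *\<^sub>R x"
      using y by (auto simp: span_singleton)
    then show ?thesis
      using assms(2) by (simp add: rho_simps span_scale)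
  qed
  then show "invariant_subspace \<rho> (span {x})"
    by (simp add: invariant_subspace_def)
  show "span {x} \<noteq> {0}"
    using assms(1) span_base[of x "{x}"] by auto
  fix W assume W: "invariant_subspace \<rho> W \<and> W \<subseteq> span {x}"
  then have sub: "subspace W"
    by (simp add: invariant_subspace_def)
  show "W = {0} \<or> W = span {x}"
  proof (cases "W = {0}")
    case False
    then obtain w where w: "w \<in> W" "w \<noteq> 0"
      using sub subspace_0 by blast
    then obtain r where "w = r *\<^sub>R x"
      using W by (auto simp: span_singleton)
    moreover from this have "r \<noteq> 0"
      using w by auto
    ultimately have "x = (1 / r) *\<^sub>R w"
      by simp
    then have "x \<in> W"
      using w sub by (metis subspace_scale)
    then have "span {x} \<subseteq> W"
      using span_minimal[of "{x}" W] sub by simp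
    then show ?thesis
      using W by auto
  qed simp
qed

text \<open>A nonzero invariant subspace of least dimension is irreducible. Positive definiteness
  lets it be split off orthogonally, and the complement has smaller dimension. Indices start at one
  to leave index 0 free for a further summand.\<close>

lemma irreducible_decomposition:
  assumes "invariant_subspace \<rho> W" "pos_def W"
  shows "\<exists>(k::nat) V. (\<forall>i\<in>{1..k}. irreducible_subspace \<rho> (V i) \<and> V i \<subseteq> W) \<and>
    (\<forall>i\<in>{1..k}. \<forall>j\<in>{1..k}. i \<noteq> j \<longrightarrow> (\<forall>x\<in>V i. \<forall>y\<in>V j. b x y = 0)) \<and>
    (\<forall>x\<in>W. \<exists>u. (\<forall>i\<in>{1..k}. u i \<in> V i) \<and> x = (\<Sum>i\<in>{1..k}. u i))"
  using assms
proof (induction "dim W" arbitrary: W rule: less_induct)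
  case less
  have W: "subspace W"
    using less.prems by (simp add: invariant_subspace_def)
  show ?case
  proof (cases "W = {0}")
    case True
    then show ?thesis
      by (intro exI[of _ "0 :: nat"] exI[of _ "\<lambda>_. {0}"]) auto
  next
    case False
    define P where "P U \<longleftrightarrow> invariant_subspace \<rho> U \<and> U \<subseteq> W \<and> U \<noteq> {0}" for U
    have "P W"
      using less.prems False by (simp add: P_def)
    then obtain U where U: "P U" and min: "\<And>U'. P U' \<Longrightarrow> dim U \<le> dim U'"
      using ex_has_least_nat[of P W dim] by blast
    have subU: "subspace U" and UW: "U \<subseteq> W"
      using U by (auto simp: P_def invariant_subspace_def)
    have irr: "irreducible_subspace \<rho> U"
      unfolding irreducible_subspace_def
    proof (intro conjI allI impI)
      fix U' assume U': "invariant_subspace \<rho> U' \<and> U' \<subseteq> U"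
      show "U' = {0} \<or> U' = U"
      proof (rule disjCI)
        assume "U' \<noteq> U"
        then have "dim U' < dim U"
          using U' subspace_dim_strict_mono[OF fin_dim, of U' U] subU
          by (auto simp: invariant_subspace_def)
        then show "U' = {0}"
          using min[of U'] U' UW by (auto simp: P_def)
      qed
    qed (use U in \<open>auto simp: P_def\<close>)
    define W' where "W' = {x \<in> W. \<forall>u\<in>U. b x u = 0}"
    have inv': "invariant_subspace \<rho> W'"
      using invariant_orthogonal less.prems U by (auto simp: W'_def P_def)
    then have W': "subspace W'" "W' \<subseteq> W"
      by (auto simp: invariant_subspace_def W'_def)
    have posU: "pos_def U" and pos': "pos_def W'"
      using less.prems UW W' by (auto simp: pos_def_def)
    obtain x where x: "x \<in> U" "x \<noteq> 0"
      using U subU subspace_0 by (auto simp: P_def)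
    then have "b x x \<noteq> 0"
      using posU by (auto simp: pos_def_def)
    then have "x \<notin> W'"
      using x by (auto simp: W'_def)
    then have "W' \<subset> W"
      using x UW W' by auto
    then have "dim W' < dim W"
      by (rule subspace_dim_strict_mono[OF fin_dim W'(1) W])
    from less.hyps[OF this inv' pos'] obtain k :: nat and V where
      V: "\<forall>i\<in>{1..k}. irreducible_subspace \<rho> (V i) \<and> V i \<subseteq> W'"
      and orth: "\<forall>i\<in>{1..k}. \<forall>j\<in>{1..k}. i \<noteq> j \<longrightarrow> (\<forall>x\<in>V i. \<forall>y\<in>V j. b x y = 0)"
      and sum: "\<forall>x\<in>W'. \<exists>u. (\<forall>i\<in>{1..k}. u i \<in> V i) \<and> x = (\<Sum>i\<in>{1..k}. u i)"
      by (elim exE conjE) (rule that)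
    define V' where "V' = V(Suc k := U)"
    have V'_eq: "V' (Suc k) = U" "\<And>i. i \<in> {1..k} \<Longrightarrow> V' i = V i"
      by (auto simp: V'_def)
    have ins: "{1..Suc k} = insert (Suc k) {1..k}"
      by auto
    have UV: "b x y = 0" "b y x = 0" if "i \<in> {1..k}" "x \<in> V i" "y \<in> U" for i x y
    proof -
      have "x \<in> W'"
        using V that by blast
      then show "b x y = 0" "b y x = 0"
        using that sym[of y x] by (auto simp: W'_def)
    qed
    show ?thesis
    proof (intro exI[of _ "Suc k"] exI[of _ V'] conjI ballI impI)
      fix i assume i: "i \<in> {1..Suc k}"
      have "irreducible_subspace \<rho> (V' i) \<and> V' i \<subseteq> W"
      proof (cases "i = Suc k")
        case True
        then show ?thesis
          using irr UW V'_eq(1) by simp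
      next
        case False
        then have "i \<in> {1..k}"
          using i by auto
        with V have "irreducible_subspace \<rho> (V i)" "V i \<subseteq> W'"
          by blast+
        then show ?thesis
          using W'(2) V'_eq(2)[OF \<open>i \<in> {1..k}\<close>] by simp
      qed
      then show "irreducible_subspace \<rho> (V' i)" "V' i \<subseteq> W"
        by simp_all
    next
      fix i j x y assume "i \<in> {1..Suc k}" "j \<in> {1..Suc k}" "i \<noteq> j" "x \<in> V' i" "y \<in> V' j"
      then show "b x y = 0"
        unfolding ins using V'_eq UV orth by (metis insertE)
    next
      fix x assume "x \<in> W"
      obtain u w where uw: "x = u + w" "u \<in> U" "\<And>y. y \<in> U \<Longrightarrow> b w y = 0"
        using orthogonal_decomposition[OF fin_dim subU posU] by blast
      have "w = x - u"
        using uw by simp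
      then have "w \<in> W"
        using subspace_diff[OF W \<open>x \<in> W\<close>] uw(2) UW by auto
      then have "w \<in> W'"
        using uw(3) by (simp add: W'_def)
      then obtain v where v: "\<forall>i\<in>{1..k}. v i \<in> V i" "w = (\<Sum>i\<in>{1..k}. v i)"
        using sum by blast
      define v' where "v' = v(Suc k := u)"
      have "(\<Sum>i\<in>{1..k}. v' i) = w"
        unfolding v(2) v'_def by (intro sum.cong) auto
      then have "x = (\<Sum>i\<in>{1..Suc k}. v' i)"
        unfolding ins using uw(1) by (simp add: v'_def)
      moreover have "\<forall>i\<in>{1..Suc k}. v' i \<in> V' i"
        unfolding ins using v(1) uw(2) by (auto simp: v'_def V'_def)
      ultimately show "\<exists>v. (\<forall>i\<in>{1..Suc k}. v i \<in> V' i) \<and> x = (\<Sum>i\<in>{1..Suc k}. v i)"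
        by blast
    qed
  qed
qed

text \<open>On a Euclidean space a symmetric form has a real eigenvalue relative to
  \<open>b\<close>. Its eigenspace in \<open>U\<close> is invariant because both forms are, so by
  irreducibility it is all of \<open>U\<close>.\<close>

lemma schur:
  assumes "irreducible_subspace \<rho> U" "pos_def U" "symmetric_form q"
    and q_inv: "\<And>Z x y. q (\<rho> Z x) y = - q x (\<rho> Z y)"
  shows "\<exists>m. \<forall>x\<in>U. \<forall>y\<in>U. q x y = m * b x y"
proof -
  interpret q: symmetric_form q by fact
  have U: "subspace U" "U \<noteq> {0}" "\<And>Z x. x \<in> U \<Longrightarrow> \<rho> Z x \<in> U"
    using assms(1) by (auto simp: irreducible_subspace_def invariant_subspace_def)
  obtain x m where x: "x \<in> U" "x \<noteq> 0" "\<And>y. y \<in> U \<Longrightarrow> q x y = m * b x y"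
    using symmetric_eigenvector[OF fin_dim U(1,2) symmetric_form_axioms assms(3)] assms(2)
    unfolding pos_def_def by metis
  let ?K = "{z \<in> U. \<forall>y\<in>U. q z y = m * b z y}"
  have "invariant_subspace \<rho> ?K"
    using U by (auto simp: invariant_subspace_def subspace_def form_simps q.form_simps rho_skew
        q_inv algebra_simps)
  then have "?K = {0} \<or> ?K = U"
    using assms(1) by (auto simp: irreducible_subspace_def)
  then have "?K = U"
    using x by blast
  then show ?thesis
    by blast
qed

text \<open>
  For commuting \<open>\<rho> Z\<close>, \<open>\<rho> W\<close> in the commutant, \<open>b (\<rho> Z x) (\<rho> W y)\<close> is an invariant symmetric
  form, hence a multiple of \<open>b\<close>.
\<close>
lemma commutant_complex_structure:
  assumes irr: "irreducible_subspace \<rho> U" and pos: "pos_def U"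
    and comm: "\<And>Z X x. Z \<in> C \<Longrightarrow> \<rho> Z (\<rho> X x) = \<rho> X (\<rho> Z x)"
  shows "if even (dim U)
    then \<exists>J\<in>so_on U b. (\<forall>x\<in>U. J (J x) = - x) \<and> (\<forall>Z\<in>C. \<exists>l::real. \<forall>x\<in>U. \<rho> Z x = l *\<^sub>R J x)
    else \<forall>Z\<in>C. \<forall>x\<in>U. \<rho> Z x = 0"
proof -
  have U: "subspace U" "\<And>Z x. x \<in> U \<Longrightarrow> \<rho> Z x \<in> U"
    using irr by (auto simp: irreducible_subspace_def invariant_subspace_def)
  have scalar: "\<exists>m. \<forall>x\<in>U. \<forall>y\<in>U. b (\<rho> Z x) (\<rho> W y) = m * b x y" if "Z \<in> C" "W \<in> C" for Z W
  proof (rule schur[OF irr pos])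
    have "b (\<rho> Z x) (\<rho> W y) = b (\<rho> Z y) (\<rho> W x)" for x y
      using rho_skew[of Z x "\<rho> W y"] rho_skew[of W x "\<rho> Z y"] comm[OF that(1), of W y]
        sym[of "\<rho> W x" "\<rho> Z y"] by simp
    then show "symmetric_form (\<lambda>x y. b (\<rho> Z x) (\<rho> W y))"
      by unfold_locales (auto simp: bilinear_def linear_iff form_simps rho_simps)
    show "b (\<rho> Z (\<rho> X x)) (\<rho> W y) = - b (\<rho> Z x) (\<rho> W (\<rho> X y))" for X x y
      by (simp only: comm[OF that(1), of X x] comm[OF that(2), of X y] rho_skew[of X])
  qed
  show ?thesis
  proof (cases "\<forall>Z\<in>C. \<forall>x\<in>U. \<rho> Z x = 0")
    case True
    \<comment> \<open>In even dimension any complex structure serves, with all factors zero.\<close>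
    then show ?thesis
      using complex_structure_exists[OF fin_dim U(1) pos] by (metis scale_zero_left)
  next
    case False
    then obtain Z x1 where Z: "Z \<in> C" and x1: "x1 \<in> U" "\<rho> Z x1 \<noteq> 0"
      by blast
    obtain m where m: "\<And>x y. x \<in> U \<Longrightarrow> y \<in> U \<Longrightarrow> b (\<rho> Z x) (\<rho> Z y) = m * b x y"
      using scalar[OF Z Z] by blast
    have "m * b x1 x1 > 0"
      using pos x1 U(2) m[OF x1(1,1)] by (auto simp: pos_def_def)
    moreover have "x1 \<noteq> 0"
      using x1 by (auto simp: rho_simps)
    then have "b x1 x1 > 0"
      using pos x1 by (auto simp: pos_def_def)
    ultimately have mpos: "m > 0"
      by (simp add: zero_less_mult_iff)
    have square: "\<rho> Z (\<rho> Z x) = - m *\<^sub>R x" if x: "x \<in> U" for x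
    proof (rule pos_def_orthogonal_eqI[OF U(1) pos])
      show "\<rho> Z (\<rho> Z x) \<in> U" "- m *\<^sub>R x \<in> U"
        using U x subspace_scale[OF U(1) x] by blast+
      show "b (\<rho> Z (\<rho> Z x)) y = b (- m *\<^sub>R x) y" if "y \<in> U" for y
        using rho_skew m[OF x that] by (simp add: form_simps)
    qed
    define J where "J x = (1 / sqrt m) *\<^sub>R \<rho> Z x" for x
    have J: "J \<in> so_on U b"
      using U rho_skew by (auto simp: so_on_def J_def rho_simps form_simps scaleR_add_right subspace_scale)
    have JJ: "J (J x) = - x" if "x \<in> U" for x
      using square[OF that] mpos by (simp add: J_def rho_simps)
    have "\<exists>l::real. \<forall>x\<in>U. \<rho> W x = l *\<^sub>R J x" if W: "W \<in> C" for W
    proof -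
      obtain c where c: "\<And>x y. x \<in> U \<Longrightarrow> y \<in> U \<Longrightarrow> b (\<rho> Z x) (\<rho> W y) = c * b x y"
        using scalar[OF Z W] by blast
      have "\<rho> W y = (c / m) *\<^sub>R \<rho> Z y" if y: "y \<in> U" for y
      proof (rule pos_def_orthogonal_eqI[OF U(1) pos])
        show "\<rho> W y \<in> U" "(c / m) *\<^sub>R \<rho> Z y \<in> U"
          using U y by (auto intro: subspace_scale)
        fix z assume z: "z \<in> U"
        \<comment> \<open>Since \<open>\<rho> Z\<close> squares to \<open>- m\<close>, it is
          invertible on \<open>U\<close>; writing the test vector as \<open>\<rho> Z x\<close> turns
          both sides into scalar forms already computed.\<close>
        have "(- 1 / m) *\<^sub>R \<rho> Z z \<in> U"
          by (rule subspace_scale[OF U(1) U(2)[OF z]])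
        moreover have "\<rho> Z ((- 1 / m) *\<^sub>R \<rho> Z z) = z"
          unfolding rho_simps square[OF z] using mpos by simp
        ultimately obtain x where x: "x \<in> U" "z = \<rho> Z x"
          by metis
        show "b (\<rho> W y) z = b ((c / m) *\<^sub>R \<rho> Z y) z"
          using c[OF x(1) y] m[OF x(1) y] mpos sym[of "\<rho> Z x"] by (simp add: x(2) form_simps)
      qed
      then have "\<forall>y\<in>U. \<rho> W y = (c / m * sqrt m) *\<^sub>R J y"
        using mpos by (simp add: J_def)
      then show ?thesis
        by blast
    qed
    moreover have "even (dim U)"
      using complex_structure_dim_even[OF fin_dim U(1) pos J JJ] .
    ultimately show ?thesis
      using J JJ by auto
  qed
qed

end

section \<open>Lorentzian data sets\<close>

locale lorentzian_data = lorentzian_data_set br bg bv \<pi>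
  for br :: "'g::real_vector \<Rightarrow> 'g \<Rightarrow> 'g" and bg and bv :: "'v::real_vector \<Rightarrow> 'v \<Rightarrow> real" and \<pi> +
  assumes lorentzian_space: "lorentzian_on UNIV bv"
begin

sublocale v: lorentzian_form bv
  by (rule lorentzian_form_if_lorentzian_on[OF lorentzian_space])

sublocale v: skew_representation bv \<pi>
  using rep_skew by unfold_locales (auto simp: v.fin_dim bilinear_rep so_on_def)

sublocale g: symmetric_form bg
  using metric_algebra by unfold_locales (auto simp: metric_on_def)

text \<open>For a timelike \<open>t\<close>, the vector \<open>(0, t)\<close> is timelike in the
  Lorentzian sum and orthogonal to every \<open>(X, 0)\<close>.\<close>

lemma algebra_pos: "g.pos_def UNIV"
  unfolding g.pos_def_def
proof (intro ballI impI)
  interpret s: lorentzian_form "sum_metric bg bv"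
    by (rule lorentzian_form_if_lorentzian_on[OF lorentzian_sum])
  fix X :: 'g assume "X \<noteq> 0"
  obtain t where "bv t t < 0"
    by (rule v.timelike_exists)
  then have "sum_metric bg bv (X, 0) (X, 0) > 0"
    using \<open>X \<noteq> 0\<close> by (intro s.orthogonal_timelike_pos[of "(0, t)"])
      (auto simp: sum_metric_def v.form_simps g.form_simps zero_prod_def)
  then show "bg X X > 0"
    by (simp add: sum_metric_def v.form_simps)
qed

lemma rep_simps:
  "\<pi> (X + Y) x = \<pi> X x + \<pi> Y x" "\<pi> (r *\<^sub>R X) x = r *\<^sub>R \<pi> X x"
  using bilinear_ladd[OF bilinear_rep] bilinear_lmul[OF bilinear_rep] by simp_all

lemma rep_sum: "\<pi> (\<Sum>i\<in>I. X i) x = (\<Sum>i\<in>I. \<pi> (X i) x)"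
  using linear_sum[of "\<lambda>X. \<pi> X x"] bilinear_rep by (simp add: bilinear_def)

lemma ad_skew: "bg (br Z X) Y = - bg X (br Z Y)"
  using ad_invariant by (auto simp: so_on_def)

lemma bracket_anticomm: "br X Y = - br Y X"
proof -
  have "br (X + Y) (X + Y) = br X X + br Y X + (br X Y + br Y Y)"
    by (simp only: bilinear_ladd[OF bilinear_bracket] bilinear_radd[OF bilinear_bracket])
  then have "br X Y + br Y X = 0"
    by (simp add: bracket_self add.commute)
  then show ?thesis
    by (simp add: eq_neg_iff_add_eq_0)
qed

text \<open>
  The form \<open>Q\<close> is minus the Casimir operator. If it were positive on the closed cone without
  the origin, it would have a timelike eigenvector \<open>x\<close>; the eigenspace is invariant and contains
  the spacelike vector \<open>\<pi> Z x\<close>, hence a lightlike vector, on which \<open>Q\<close> vanishes.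
\<close>
lemma lightlike_eigenvector:
  obtains e where "lightlike bv e" "\<And>Z. \<pi> Z e \<in> span {e}"
proof -
  obtain E where E: "finite E" "g.orthonormal E" "span E = UNIV"
    by (rule g.orthonormal_basis[OF finite_dim_algebra subspace_UNIV algebra_pos])
  have expand: "X = (\<Sum>i\<in>E. bg X i *\<^sub>R i)" for X
    by (rule g.orthonormal_expansion[OF E(1,2)]) (simp add: E(3))
  define Q where "Q x y = (\<Sum>i\<in>E. bv (\<pi> i x) (\<pi> i y))" for x y
  interpret Q: symmetric_form Q
  proof
    show "Q x y = Q y x" for x y
      unfolding Q_def by (intro sum.cong) (auto simp: v.sym)
    show "bilinear Q"
      by (simp add: Q_def bilinear_def linear_iff v.form_simps v.rho_simps sum.distrib sum_distrib_left)
  qed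
  have Q_inv: "Q (\<pi> Z x) y = - Q x (\<pi> Z y)" for Z x y
  proof -
    \<comment> \<open>The matrix of \<open>- ad Z\<close> in the orthonormal basis. Commuting
      \<open>\<pi> Z\<close> past \<open>\<pi> i\<close> leaves two double sums weighted by
      \<open>a\<close>, which cancel because \<open>a\<close> is antisymmetric.\<close>
    define a where "a i j = bg (br i Z) j" for i j
    have a: "a j i = - a i j" for i j
      using ad_skew[of Z i j] bracket_anticomm[of i Z] bracket_anticomm[of j Z] g.sym[of i "br Z j"]
      by (simp add: a_def g.form_simps)
    have br: "\<pi> (br i Z) x = (\<Sum>j\<in>E. a i j *\<^sub>R \<pi> j x)" for i x
      by (subst expand[of "br i Z"]) (simp add: rep_sum rep_simps a_def)
    have "bv (\<pi> i (\<pi> Z x)) (\<pi> i y) + bv (\<pi> i x) (\<pi> i (\<pi> Z y)) =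
        bv (\<pi> (br i Z) x) (\<pi> i y) + bv (\<pi> i x) (\<pi> (br i Z) y)" for i
      unfolding rep_bracket by (simp add: v.form_simps v.rho_skew[of Z])
    then have "Q (\<pi> Z x) y + Q x (\<pi> Z y) =
        (\<Sum>i\<in>E. bv (\<pi> (br i Z) x) (\<pi> i y) + bv (\<pi> i x) (\<pi> (br i Z) y))"
      by (simp add: Q_def sum.distrib[symmetric])
    also have "\<dots> = (\<Sum>i\<in>E. \<Sum>j\<in>E. a i j * bv (\<pi> j x) (\<pi> i y)) +
        (\<Sum>i\<in>E. \<Sum>j\<in>E. a i j * bv (\<pi> i x) (\<pi> j y))"
      by (simp add: br v.sum_left v.sum_right v.form_simps sum.distrib)
    also have "(\<Sum>i\<in>E. \<Sum>j\<in>E. a i j * bv (\<pi> j x) (\<pi> i y)) =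
        (\<Sum>j\<in>E. \<Sum>i\<in>E. - (a j i * bv (\<pi> j x) (\<pi> i y)))"
    proof (subst sum.swap, intro sum.cong refl)
      fix i j
      show "a i j * bv (\<pi> j x) (\<pi> i y) = - (a j i * bv (\<pi> j x) (\<pi> i y))"
        by (subst a) simp
    qed
    finally show ?thesis
      by (simp add: sum_negf)
  qed
  have "\<exists>e. lightlike bv e \<and> Q e e = 0"
  proof (rule ccontr)
    assume no_null: "\<nexists>e. lightlike bv e \<and> Q e e = 0"
    have rep_orth: "bv (\<pi> Z x) x = 0" for Z x
      using v.rho_skew[of Z x x] v.sym[of x "\<pi> Z x"] by simp
    have Q_pos: "Q x x > 0" if x: "x \<noteq> 0" "bv x x \<le> 0" for x
    proof (cases "bv x x = 0")
      case True
      then have light: "lightlike bv x"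
        using x by (simp add: lightlike_def)
      then have "Q x x \<ge> 0"
        unfolding Q_def using rep_orth by (intro sum_nonneg v.orthogonal_lightlike_nonneg) auto
      then show ?thesis
        using no_null light by force
    next
      case False
      then have neg: "bv x x < 0"
        using x by simp
      have nn: "bv (\<pi> i x) (\<pi> i x) \<ge> 0" for i
        using v.orthogonal_timelike_nonneg[OF neg rep_orth] .
      obtain Z where "\<pi> Z x \<noteq> 0"
        using common_kernel x(1) by auto
      then have "\<exists>i\<in>E. \<pi> i x \<noteq> 0"
        by (subst (asm) expand[of Z]) (auto simp: rep_sum rep_simps intro: ccontr)
      then obtain i where i: "i \<in> E" "\<pi> i x \<noteq> 0"
        by blast
      then have "bv (\<pi> i x) (\<pi> i x) > 0"
        using v.orthogonal_timelike_pos[OF neg rep_orth] by blast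
      then show ?thesis
        unfolding Q_def using i E nn by (intro sum_pos2[of E i]) auto
    qed
    obtain t where t: "bv t t < 0"
      by (rule v.timelike_exists)
    \<comment> \<open>The metric with its sign flipped along \<open>t\<close>: an auxiliary
      Euclidean form whose unit sphere provides compactness.\<close>
    define g where "g x y = bv x y - 2 / bv t t * (bv x t * bv y t)" for x y
    have g: "symmetric_form g"
      using v.sym
      by unfold_locales (auto simp: g_def bilinear_def linear_iff v.form_simps algebra_simps add_divide_distrib)
    have g_pos: "g y y > 0" if "y \<noteq> 0" for y
    proof -
      define z where "z = y - (bv y t / bv t t) *\<^sub>R t"
      have z: "bv z t = 0"
        using t by (simp add: z_def v.form_simps)
      have y: "y = z + (bv y t / bv t t) *\<^sub>R t"
        by (simp add: z_def)
      have "bv y y = bv z z + (bv y t)\<^sup>2 / bv t t"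
        using t by (subst (1 2) y) (simp add: v.form_simps z v.sym[of t z] power2_eq_square)
      then have gy: "g y y = bv z z + (bv y t)\<^sup>2 / (- bv t t)"
        using t by (simp add: g_def power2_eq_square field_simps)
      have nn: "(bv y t)\<^sup>2 / (- bv t t) \<ge> 0"
        using t by (intro divide_nonneg_pos) auto
      show ?thesis
      proof (cases "z = 0")
        case True
        then have "bv y t \<noteq> 0"
          using that y by auto
        then have "(bv y t)\<^sup>2 / (- bv t t) > 0"
          using t by (intro divide_pos_pos) auto
        then show ?thesis
          using gy True by (simp add: v.form_simps)
      next
        case False
        then have "bv z z > 0"
          by (rule v.orthogonal_timelike_pos[OF t z])
        then show ?thesis
          using gy nn by simp
      qed
    qed
    obtain x m where x: "bv x x < 0" "\<And>y. bv x y = - m * Q x y"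
      using pencil_eigenvector[OF v.fin_dim subspace_UNIV g v.symmetric_form_axioms
          Q.symmetric_form_axioms g_pos Q_pos UNIV_I t] by (metis UNIV_I)
    have "x \<noteq> 0"
      using x(1) by (auto simp: v.form_simps)
    have "m \<noteq> 0"
      using x(1) x(2)[of x] by auto
    obtain Z where Z: "\<pi> Z x \<noteq> 0"
      using common_kernel \<open>x \<noteq> 0\<close> by auto
    define y where "y = \<pi> Z x"
    have y: "bv y y > 0"
      unfolding y_def by (rule v.orthogonal_timelike_pos[OF x(1) rep_orth Z])
    \<comment> \<open>Both forms are invariant, so \<open>\<pi> Z x\<close> satisfies the same
      eigenvector equation as \<open>x\<close>.\<close>
    have eig_y: "bv y z = - m * Q y z" for z
      using x(2) by (simp add: y_def v.rho_skew Q_inv)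
    \<comment> \<open>As \<open>x\<close> is timelike and \<open>y\<close> spacelike and orthogonal
      to it, this \<open>s\<close> balances the two squares and makes \<open>e\<close> null.\<close>
    define s where "s = sqrt (- bv x x / bv y y)"
    define e where "e = x + s *\<^sub>R y"
    have "s\<^sup>2 = - bv x x / bv y y"
      unfolding s_def using x(1) y by (intro real_sqrt_pow2 divide_nonneg_pos) auto
    then have s: "s * (s * bv y y) = - bv x x"
      using y by (simp add: power2_eq_square field_simps)
    have xy: "bv y x = 0" "bv x y = 0"
      using rep_orth[of Z x] v.sym[of x y] by (simp_all add: y_def)
    have "bv e x = bv x x"
      by (simp add: e_def v.form_simps xy)
    then have "e \<noteq> 0"
      using x(1) by (auto simp: v.form_simps)
    moreover have ee: "bv e e = 0"
      using s by (simp add: e_def v.form_simps xy)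
    moreover have "bv e e = - m * Q e e"
      unfolding e_def by (simp add: v.form_simps Q.form_simps x(2) eig_y algebra_simps)
    ultimately show False
      using no_null \<open>m \<noteq> 0\<close> by (auto simp: lightlike_def)
  qed
  then obtain e where e: "lightlike bv e" "Q e e = 0"
    by blast
  have orth: "bv (\<pi> Z e) e = 0" for Z
    using v.rho_skew[of Z e e] v.sym[of e "\<pi> Z e"] by simp
  have "\<forall>i\<in>E. bv (\<pi> i e) (\<pi> i e) = 0"
    using e(2) v.orthogonal_lightlike_nonneg[OF e(1) orth] E(1)
    by (simp add: Q_def sum_nonneg_eq_0_iff)
  then have line: "\<pi> i e \<in> span {e}" if "i \<in> E" for i
    using v.orthogonal_lightlike_null[OF e(1) orth] that by blast
  have "\<pi> Z e \<in> span {e}" for Z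
    by (subst expand[of Z]) (auto simp: rep_sum rep_simps intro!: span_sum span_scale line)
  then show ?thesis
    using that e(1) by blast
qed

text \<open>
  The weight of the lightlike eigenvector vanishes on brackets, so its \<open>bg\<close>-dual \<open>H\<close> is central;
  since \<open>\<pi> H\<close> is skew, minus its eigenvalue on \<open>e\<close> is an eigenvalue as well.
\<close>
lemma hyperbolic_center:
  obtains e f H l where "lightlike bv e" "lightlike bv f" "bv e f \<noteq> 0"
    "\<And>Z. \<pi> Z e \<in> span {e}" "\<And>Z. \<pi> Z f \<in> span {f}"
    "l \<noteq> 0" "\<pi> H e = l *\<^sub>R e" "\<pi> H f = - l *\<^sub>R f"
proof -
  obtain e where e: "lightlike bv e" "\<And>Z. \<pi> Z e \<in> span {e}"
    by (rule lightlike_eigenvector) blast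
  then have e': "e \<noteq> 0" "bv e e = 0"
    by (auto simp: lightlike_def)
  obtain t where t: "bv t t < 0"
    by (rule v.timelike_exists)
  have et: "bv e t \<noteq> 0"
    using v.orthogonal_timelike_pos[OF t, of e] e' by auto
  \<comment> \<open>Pairing with a timelike vector reads off the eigenvalue by a formula visibly
    linear in \<open>Z\<close>; pairing with \<open>e\<close> itself would give zero.\<close>
  define w where "w Z = bv (\<pi> Z e) t / bv e t" for Z
  have we: "\<pi> Z e = w Z *\<^sub>R e" for Z
  proof -
    obtain r where "\<pi> Z e = r *\<^sub>R e"
      using e(2)[of Z] by (auto simp: span_singleton)
    then show ?thesis
      using et by (simp add: w_def v.form_simps)
  qed
  have w_lin: "linear w"
    by (intro linearI) (simp_all add: w_def rep_simps v.form_simps add_divide_distrib)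
  obtain E where E: "finite E" "g.orthonormal E" "span E = UNIV"
    by (rule g.orthonormal_basis[OF finite_dim_algebra subspace_UNIV algebra_pos])
  define H where "H = (\<Sum>i\<in>E. w i *\<^sub>R i)"
  have H: "bg X H = w X" for X
  proof -
    have "bg X H = (\<Sum>i\<in>E. w (bg X i *\<^sub>R i))"
      by (simp add: H_def g.sum_right g.form_simps linear_scale[OF w_lin] mult.commute)
    also have "\<dots> = w (\<Sum>i\<in>E. bg X i *\<^sub>R i)"
      by (rule linear_sum[OF w_lin, symmetric])
    also have "(\<Sum>i\<in>E. bg X i *\<^sub>R i) = X"
      by (rule g.orthonormal_expansion[OF E(1,2), symmetric]) (simp add: E(3))
    finally show ?thesis .
  qed
  have "\<pi> (br X Y) e = 0" for X Y
    unfolding rep_bracket by (simp add: we v.rho_simps mult.commute)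
  then have "w (br X Y) = 0" for X Y
    by (simp add: w_def v.form_simps)
  \<comment> \<open>Invariance of \<open>bg\<close> turns this into \<open>- w (br X Y)\<close>;
    definiteness then makes \<open>H\<close> central.\<close>
  then have "bg (br X H) Y = 0" for X Y
    using ad_skew[of X Y H] H[of "br X Y"] g.sym[of Y] by simp
  then have "br X H = 0" for X
    using algebra_pos by (metis UNIV_I g.pos_def_def less_irrefl)
  then have comm: "\<pi> H (\<pi> X x) = \<pi> X (\<pi> H x)" for X x
    using rep_bracket[of X H x] bilinear_lzero[OF bilinear_rep] by simp
  \<comment> \<open>Equal to \<open>bg H H\<close>, hence positive once \<open>H\<close> is nonzero;
    and \<open>H\<close> is nonzero because some \<open>\<pi> Z\<close> moves
    \<open>e\<close>.\<close>
  define l where "l = w H"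
  obtain Z where "\<pi> Z e \<noteq> 0"
    using common_kernel e' by auto
  then have "H \<noteq> 0"
    using H[of Z] we[of Z] by (auto simp: g.form_simps)
  then have l: "l \<noteq> 0"
    using algebra_pos H[of H] by (auto simp: l_def g.pos_def_def)
  \<comment> \<open>By skewness the image of \<open>A\<close> is orthogonal to \<open>e\<close>, so
    \<open>A\<close> is not surjective and has a kernel.\<close>
  define A where "A x = \<pi> H x + l *\<^sub>R x" for x
  have A: "linear A"
    by (intro linearI) (simp_all add: A_def v.rho_simps algebra_simps)
  have "bv e (A x) = 0" for x
    using v.rho_skew[of H e x] by (simp add: A_def v.form_simps we l_def)
  then have "\<not> surj A"
    using v.nondegenerate[of e] e' by (metis surjD)
  then have "\<not> inj A"
    using inj_linear_imp_surj[OF v.fin_dim A] by blast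
  then obtain f where f: "f \<noteq> 0" "A f = 0"
    using linear_inj_iff_eq_0[OF A] by blast
  have Hf: "\<pi> H f = - l *\<^sub>R f"
    using f(2) by (simp add: A_def eq_neg_iff_add_eq_0)
  have null: "bv x y = 0" if "\<pi> H x = - l *\<^sub>R x" "\<pi> H y = - l *\<^sub>R y" for x y
    using v.rho_skew[of H x y] l that by (simp add: v.form_simps)
  have light: "lightlike bv f"
    using f null[OF Hf Hf] by (simp add: lightlike_def)
  have "\<pi> Z f \<in> span {f}" for Z
  proof -
    have "\<pi> H (\<pi> Z f) = - l *\<^sub>R \<pi> Z f"
      by (simp add: comm Hf v.rho_simps)
    then show ?thesis
      using v.orthogonal_lightlike_null[OF light] null Hf by blast
  qed
  moreover have "bv e f \<noteq> 0"
  proof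
    \<comment> \<open>Orthogonal lightlike vectors are proportional, so \<open>f\<close> would have
      both eigenvalues \<open>l\<close> and \<open>- l\<close>.\<close>
    assume "bv e f = 0"
    then have "f \<in> span {e}"
      using v.orthogonal_lightlike_null[OF e(1), of f] null[OF Hf Hf] v.sym[of e f] by simp
    then obtain r where "f = r *\<^sub>R e"
      by (auto simp: span_singleton)
    then have "\<pi> H f = l *\<^sub>R f"
      by (simp add: v.rho_simps we l_def)
    then have "l *\<^sub>R f = - (l *\<^sub>R f)"
      using Hf by simp
    then have "(l + l) *\<^sub>R f = 0"
      by (simp only: scaleR_add_left eq_neg_iff_add_eq_0)
    then show False
      using l f by simp
  qed
  ultimately show ?thesis
    using that[OF e(1) light _ e(2)] l we[of H] Hf by (auto simp: l_def)
qed

end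

section \<open>The hyperbolic plane and the splitting of its orthogonal complement\<close>

theorem theorem6p8:
  fixes br :: "'g::real_vector \<Rightarrow> 'g \<Rightarrow> 'g"
    and bg :: "'g \<Rightarrow> 'g \<Rightarrow> real"
    and bv :: "'v::real_vector \<Rightarrow> 'v \<Rightarrow> real"
    and \<pi> :: "'g \<Rightarrow> 'v \<Rightarrow> 'v"
  assumes "lorentzian_data_set br bg bv \<pi>"
    and "lorentzian_on UNIV bv"
  shows "\<exists>(k::nat) V.
      orthogonal_sum bv {0..k} V UNIV \<and>
      (\<forall>i\<in>{0..k}. invariant_subspace \<pi> (V i)) \<and>
      (\<forall>i\<in>{1..k}. riemannian_on (V i) bv \<and> irreducible_subspace \<pi> (V i)) \<and>
      lorentzian_on (V 0) bv \<and> dim (V 0) = 2 \<and>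
      (\<exists>e f. lightlike bv e \<and> lightlike bv f \<and>
         irreducible_subspace \<pi> (span {e}) \<and> irreducible_subspace \<pi> (span {f}) \<and>
         span {e} \<inter> span {f} = {0} \<and>
         V 0 = {x + y |x y. x \<in> span {e} \<and> y \<in> span {f}}) \<and>
      (\<forall>i\<in>{1..k}.
         if even (dim (V i))
         then \<exists>J\<in>so_on (V i) bv. (\<forall>x\<in>V i. J (J x) = - x) \<and>
           (\<forall>Z\<in>lie_center br. \<exists>l::real. \<forall>x\<in>V i. \<pi> Z x = l *\<^sub>R J x)
         else \<forall>Z\<in>lie_center br. \<forall>x\<in>V i. \<pi> Z x = 0) \<and>
      (\<exists>J\<in>so_on (V 0) bv. (\<forall>x\<in>V 0. J (J x) = x) \<and>
         (\<forall>Z\<in>lie_center br. \<exists>l::real. \<forall>x\<in>V 0. \<pi> Z x = l *\<^sub>R J x))"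
proof -
  interpret lorentzian_data br bg bv \<pi>
    using assms by (simp add: lorentzian_data_def lorentzian_data_axioms_def)
  obtain e f H l where e: "lightlike bv e" and f: "lightlike bv f" and ef: "bv e f \<noteq> 0"
    and eZ: "\<And>Z. \<pi> Z e \<in> span {e}" and fZ: "\<And>Z. \<pi> Z f \<in> span {f}"
    and l: "l \<noteq> 0" "\<pi> H e = l *\<^sub>R e" "\<pi> H f = - l *\<^sub>R f"
    by (rule hyperbolic_center) blast
  have e': "e \<noteq> 0" "bv e e = 0" and f': "f \<noteq> 0" "bv f f = 0"
    using e f by (auto simp: lightlike_def)
  note ee = e'(2) f'(2) v.sym[of f e]
  let ?V0 = "span {e, f}"
  \<comment> \<open>Skewness forces opposite eigenvalues on two lightlike vectors that are not
    orthogonal.\<close>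
  have weight: "\<exists>c. \<pi> Z e = c *\<^sub>R e \<and> \<pi> Z f = - c *\<^sub>R f" for Z
  proof -
    obtain c d where cd: "\<pi> Z e = c *\<^sub>R e" "\<pi> Z f = d *\<^sub>R f"
      using eZ[of Z] fZ[of Z] by (auto simp: span_singleton)
    then have "(c + d) * bv e f = 0"
      using v.rho_skew[of Z e f] by (simp add: v.form_simps distrib_right)
    then have "d = - c"
      using ef by auto
    then show ?thesis
      using cd by auto
  qed
  have inv0: "invariant_subspace \<pi> ?V0"
    unfolding invariant_subspace_def
  proof (intro conjI allI ballI)
    fix Z x assume "x \<in> ?V0"
    then obtain r s where x: "x = r *\<^sub>R e + s *\<^sub>R f"
      unfolding span_pair by blast
    obtain c where "\<pi> Z e = c *\<^sub>R e" "\<pi> Z f = - c *\<^sub>R f"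
      using weight by blast
    then have "\<pi> Z x = (r * c) *\<^sub>R e + (s * - c) *\<^sub>R f"
      by (simp add: x v.rho_simps)
    then show "\<pi> Z x \<in> ?V0"
      unfolding span_pair by blast
  qed simp
  note plane = v.hyperbolic_plane[OF e f ef]
  define W where "W = {x \<in> UNIV. \<forall>u\<in>?V0. bv x u = 0}"
  have invW: "invariant_subspace \<pi> W"
    unfolding W_def by (rule v.invariant_orthogonal[OF _ inv0]) (simp add: invariant_subspace_def)
  obtain t where t: "t \<in> ?V0" "bv t t < 0"
    using plane(3) by blast
  have posW: "v.pos_def W"
    using v.orthogonal_timelike_pos[OF t(2)] t(1) by (auto simp: v.pos_def_def W_def)
  obtain k :: nat and U where
    U: "\<forall>i\<in>{1..k}. irreducible_subspace \<pi> (U i) \<and> U i \<subseteq> W"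
    and orth: "\<forall>i\<in>{1..k}. \<forall>j\<in>{1..k}. i \<noteq> j \<longrightarrow> (\<forall>x\<in>U i. \<forall>y\<in>U j. bv x y = 0)"
    and sum: "\<forall>x\<in>W. \<exists>u. (\<forall>i\<in>{1..k}. u i \<in> U i) \<and> x = (\<Sum>i\<in>{1..k}. u i)"
    using v.irreducible_decomposition[OF invW posW] by (elim exE conjE) (rule that)
  define V where "V = U(0 := ?V0)"
  have V0: "V 0 = ?V0" and Vi: "\<And>i. i \<in> {1..k} \<Longrightarrow> V i = U i"
    by (auto simp: V_def)
  have irr: "irreducible_subspace \<pi> (V i)" and VW: "V i \<subseteq> W" and pos: "v.pos_def (V i)"
    if "i \<in> {1..k}" for i
  proof -
    show "irreducible_subspace \<pi> (V i)" and VW: "V i \<subseteq> W"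
      using U Vi[OF that] that by auto
    then show "v.pos_def (V i)"
      using posW by (auto simp: v.pos_def_def)
  qed
  have ins: "{0..k} = insert 0 {1..k}"
    by auto
  have inv: "invariant_subspace \<pi> (V i)" if "i \<in> {0..k}" for i
    using that irr[of i] inv0 V0 unfolding ins by (auto simp: irreducible_subspace_def)
  have V0W: "bv x y = 0" "bv y x = 0" if "x \<in> W" "y \<in> V 0" for x y
    using that V0 v.sym[of y x] by (auto simp: W_def)
  have osum: "orthogonal_sum bv {0..k} V UNIV"
  proof (rule v.orthogonal_sumI)
    show "subspace (V i)" if "i \<in> {0..k}" for i
      using inv[OF that] by (simp add: invariant_subspace_def)
    show "bv x y = 0" if ij: "i \<in> {0..k}" "j \<in> {0..k}" "i \<noteq> j" "x \<in> V i" "y \<in> V j" for i j x y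
    proof -
      consider "i = 0" "j \<in> {1..k}" | "i \<in> {1..k}" "j = 0" | "i \<in> {1..k}" "j \<in> {1..k}"
        using ij(1-3) unfolding ins by auto
      then show ?thesis
      proof cases
        case 1
        then show ?thesis
          using V0W(2)[of y x] VW[of j] ij(4,5) by blast
      next
        case 2
        then show ?thesis
          using V0W(1)[of x y] VW[of i] ij(4,5) by blast
      next
        case 3
        then show ?thesis
          using orth Vi ij(3-5) by metis
      qed
    qed
    show "x = 0" if "i \<in> {0..k}" "x \<in> V i" "\<And>y. y \<in> V i \<Longrightarrow> bv x y = 0" for i x
    proof (cases "i = 0")
      case True
      then show ?thesis
        using plane(1) that V0 by (auto simp: lorentzian_on_def metric_on_def)
    next
      case False
      then have "v.pos_def (V i)"
        using that by (intro pos) auto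
      then show ?thesis
        using that(2,3) by (force simp: v.pos_def_def)
    qed
    fix x
    \<comment> \<open>The projection of \<open>x\<close> to the plane. The coefficients are crossed
      because \<open>e\<close> and \<open>f\<close> are null and each is dual to the other.\<close>
    define u where "u = (bv x f / bv e f) *\<^sub>R e + (bv x e / bv e f) *\<^sub>R f"
    have u: "u \<in> ?V0"
      unfolding span_pair u_def by blast
    have "bv (x - u) e = 0" "bv (x - u) f = 0"
      using ef by (simp_all add: u_def v.form_simps ee)
    then have "x - u \<in> W"
      by (auto simp: W_def span_pair v.form_simps(2,6))
    then obtain w where w: "\<forall>i\<in>{1..k}. w i \<in> U i" "x - u = (\<Sum>i\<in>{1..k}. w i)"
      using sum by blast
    define w' where "w' = w(0 := u)"
    have "(\<Sum>i\<in>{1..k}. w' i) = x - u"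
      unfolding w(2) w'_def by (intro sum.cong) auto
    then have "x = (\<Sum>i\<in>{0..k}. w' i)"
      unfolding ins by (simp add: w'_def)
    moreover have "\<forall>i\<in>{0..k}. w' i \<in> V i"
      unfolding ins using w(1) u by (auto simp: w'_def V_def)
    ultimately show "\<exists>w. (\<forall>i\<in>{0..k}. w i \<in> V i) \<and> x = (\<Sum>i\<in>{0..k}. w i)"
      by blast
  qed simp
  have riem: "riemannian_on (V i) bv" if "i \<in> {1..k}" for i
    using pos[OF that] v.bilinear v.sym
    by (force simp: riemannian_on_def metric_on_def v.pos_def_def)
  have comm: "\<pi> Z (\<pi> X x) = \<pi> X (\<pi> Z x)" if "Z \<in> lie_center br" for Z X x
    using rep_bracket[of Z X x] bilinear_lzero[OF bilinear_rep] that by (simp add: lie_center_def)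
  \<comment> \<open>Normalised to be 1 on \<open>e\<close> and -1 on \<open>f\<close>; skewness is
    inherited from \<open>\<pi> H\<close>.\<close>
  define J where "J x = (1 / l) *\<^sub>R \<pi> H x" for x
  have J: "J x = r *\<^sub>R e - s *\<^sub>R f" if "x = r *\<^sub>R e + s *\<^sub>R f" for x r s
    using l by (simp add: J_def that v.rho_simps algebra_simps)
  have J0: "\<exists>J\<in>so_on (V 0) bv. (\<forall>x\<in>V 0. J (J x) = x) \<and>
      (\<forall>Z\<in>lie_center br. \<exists>l::real. \<forall>x\<in>V 0. \<pi> Z x = l *\<^sub>R J x)"
  proof (intro bexI[of _ J] conjI ballI)
    show "J \<in> so_on (V 0) bv"
      using inv0 v.rho_skew
      by (auto simp: V0 so_on_def J_def v.rho_simps v.form_simps scaleR_add_right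
          invariant_subspace_def span_scale)
    show "J (J x) = x" if "x \<in> V 0" for x
    proof -
      obtain r s where x: "x = r *\<^sub>R e + s *\<^sub>R f"
        using \<open>x \<in> V 0\<close> unfolding V0 span_pair by blast
      show ?thesis
        using J[OF x] J[of "J x" r "- s"] x by simp
    qed
    fix Z
    \<comment> \<open>The algebra so(1,1) is one-dimensional: opposite weights on \<open>e\<close>
      and \<open>f\<close> mean a multiple of \<open>J\<close>.\<close>
    obtain c where c: "\<pi> Z e = c *\<^sub>R e" "\<pi> Z f = - c *\<^sub>R f"
      using weight by blast
    have "\<pi> Z x = c *\<^sub>R J x" if "x \<in> V 0" for x
    proof -
      obtain r s where x: "x = r *\<^sub>R e + s *\<^sub>R f"
        using \<open>x \<in> V 0\<close> unfolding V0 span_pair by blast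
      show ?thesis
        unfolding J[OF x] by (simp add: x v.rho_simps c algebra_simps)
    qed
    then show "\<exists>l::real. \<forall>x\<in>V 0. \<pi> Z x = l *\<^sub>R J x"
      by blast
  qed
  have disj: "span {e} \<inter> span {f} = {0}"
  proof -
    have "x = 0" if "x \<in> span {e}" "x \<in> span {f}" for x
    proof -
      obtain r where r: "x = r *\<^sub>R e"
        using \<open>x \<in> span {e}\<close> by (auto simp: span_singleton)
      have "bv x f = 0"
        using \<open>x \<in> span {f}\<close> f'(2) by (auto simp: span_singleton v.form_simps)
      then show ?thesis
        using ef by (simp add: r v.form_simps)
    qed
    then show ?thesis
      using span_0 by blast
  qed
  have "V 0 = {x + y |x y. x \<in> span {e} \<and> y \<in> span {f}}"
    unfolding V0 set_eq_iff span_pair by (auto simp: span_singleton)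
  then have lines: "\<exists>e f. lightlike bv e \<and> lightlike bv f \<and>
      irreducible_subspace \<pi> (span {e}) \<and> irreducible_subspace \<pi> (span {f}) \<and>
      span {e} \<inter> span {f} = {0} \<and> V 0 = {x + y |x y. x \<in> span {e} \<and> y \<in> span {f}}"
    using e f v.irreducible_line[OF e'(1) eZ] v.irreducible_line[OF f'(1) fZ] disj by blast
  show ?thesis
    by (intro exI[of _ k] exI[of _ V] conjI osum ballI inv riem irr lines J0
        v.commutant_complex_structure[OF irr pos comm]) (use plane V0 in auto)
qed

end
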